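(* Let $A_+,A_->0$ and $t_+,t_->0$ be fixed, and let $B\in\mathbb{R}$ be such that $B^2<A_+A_-$. For $n_+,n_-\in\mathbb{Z}$ let $\Psi(x;B)=[f_+(r;B)e^{in_+\theta},f_-(r;B)e^{in_-\theta}]$ be the equivariant solution with degree pair $[n_+,n_-]$ for the parameters $A_\pm,t_\pm,B$; that is, $[f_+(\cdot;B),f_-(\cdot;B)]$ is the unique solution of the radial problem (R) stated in the context. (i) If $B<0$, then $f_\pm'(r;B)\ge0$ for all $r>0$ and for any degree pair $[n_+,n_-]$. (ii) If $B>0$, $n_+\ge1$ and $n_-=0$, then $f_+'(r;B)\ge0$ and $f_-'(r;B)\le0$ for all $r>0$. (iii) For any pair $[n_+,n_-]$ with $n_+\ne0\ne n_-$, there exists $B_0>0$ such that $f_\pm'(r;B)\ge0$ for all $r>0$ and all $B$ (with $B^2<A_+A_-$) satisfying $0\le B\le B_0$.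
   Context: The radial problem (R) with degree pair $[n_+,n_-]$ and parameters $A_\pm,t_\pm,B$, for real-valued functions $f_+,f_-$ on $[0,\infty)$, is \begin{gather*} -f_+''-\tfrac1r f_+'+\tfrac{n_+^2}{r^2}f_++[A_+(f_+^2-t_+^2)+B(f_-^2-t_-^2)]f_+=0,\quad r\in(0,\infty),\\ -f_-''-\tfrac1r f_-'+\tfrac{n_-^2}{r^2}f_-+[A_-(f_-^2-t_-^2)+B(f_+^2-t_+^2)]f_-=0,\quad r\in(0,\infty),\\ f_\pm(r)\ge0\ \text{for all } r\in[0,\infty),\qquad f_\pm(r)\to t_\pm\ \text{as } r\to\infty,\\ f_\pm(0)=0\ \text{if } n_\pm\ne0,\qquad f_\pm'(0)=0\ \text{if } n_\pm=0. \end{gather*} Under the hypotheses $A_\pm>0$, $t_\pm>0$, $B^2<A_+A_-$ this problem has exactly one solution for each $[n_+,n_-]\in\mathbb{Z}^2$, and it is smooth on $(0,\infty)$. Primes denote derivatives in $r$; statements with $\pm$ hold for both signs. *)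

theory Defs
  imports "HOL-Analysis.Analysis"
begin

text \<open>The radial problem for profiles on \<open>[0,\<infinity>)\<close>, represented by total functions
  \<open>real \<Rightarrow> real\<close> whose values at negative arguments are irrelevant.

  One of the two coupled equations: \<open>f\<close> is the unknown with degree \<open>n\<close>, coefficient \<open>A\<close> and
  limit value \<open>t\<close>; \<open>g\<close> is the other component, with limit value \<open>s\<close>.  The differentiability
  clauses are needed because \<open>deriv\<close> is total.\<close>

definition radial_equation ::
  "real \<Rightarrow> real \<Rightarrow> real \<Rightarrow> real \<Rightarrow> int \<Rightarrow> (real \<Rightarrow> real) \<Rightarrow> (real \<Rightarrow> real) \<Rightarrow> bool" where
  "radial_equation A t B s n f g \<longleftrightarrow>
     (\<forall>r>0. f differentiable (at r) \<and> deriv f differentiable (at r) \<and>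
        - deriv (deriv f) r - 1 / r * deriv f r + (of_int n)\<^sup>2 / r\<^sup>2 * f r
          + (A * ((f r)\<^sup>2 - t\<^sup>2) + B * ((g r)\<^sup>2 - s\<^sup>2)) * f r = 0)"

text \<open>Continuity on the closed half-line gives the value prescribed at \<open>0\<close> its meaning as a
  boundary value; the derivative at \<open>0\<close> is one-sided.\<close>

definition radial_boundary_conditions :: "int \<Rightarrow> real \<Rightarrow> (real \<Rightarrow> real) \<Rightarrow> bool" where
  "radial_boundary_conditions n t f \<longleftrightarrow>
     continuous_on {0..} f \<and>
     (\<forall>r\<ge>0. f r \<ge> 0) \<and>
     (f \<longlongrightarrow> t) at_top \<and>
     (n \<noteq> 0 \<longrightarrow> f 0 = 0) \<and>
     (n = 0 \<longrightarrow> (f has_real_derivative 0) (at 0 within {0..}))"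

definition radial_solution ::
  "real \<Rightarrow> real \<Rightarrow> real \<Rightarrow> real \<Rightarrow> real \<Rightarrow> int \<Rightarrow> int \<Rightarrow> (real \<Rightarrow> real) \<Rightarrow> (real \<Rightarrow> real) \<Rightarrow> bool" where
  "radial_solution A\<^sub>p A\<^sub>m t\<^sub>p t\<^sub>m B n\<^sub>p n\<^sub>m f\<^sub>p f\<^sub>m \<longleftrightarrow>
     radial_equation A\<^sub>p t\<^sub>p B t\<^sub>m n\<^sub>p f\<^sub>p f\<^sub>m \<and>
     radial_equation A\<^sub>m t\<^sub>m B t\<^sub>p n\<^sub>m f\<^sub>m f\<^sub>p \<and>
     radial_boundary_conditions n\<^sub>p t\<^sub>p f\<^sub>p \<and>
     radial_boundary_conditions n\<^sub>m t\<^sub>m f\<^sub>m"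

end

theory Submission
  imports Defs
begin

text \<open>Differentiating the equations gives a linear system for \<open>p = f\<^sub>+' / f\<^sub>+\<close> and
  \<open>q = f\<^sub>-' / f\<^sub>-\<close> in divergence form, with sources \<open>2 n\<^sub>\<plusminus>\<^sup>2 f\<^sub>\<plusminus>\<^sup>2 / r\<^sup>2 \<ge> 0\<close> and a zeroth order part
  which is positive definite because \<open>B\<^sup>2 < A\<^sub>+ A\<^sub>-\<close>.  For \<open>B < 0\<close> the system is cooperative, and
  testing it with the negative parts of \<open>p\<close> and \<open>q\<close> shows that these vanish.  For \<open>B > 0\<close> and
  \<open>n\<^sub>- = 0\<close> the same holds for \<open>p\<close> and \<open>- q\<close>.  If both degrees are nonzero, comparison functions
  give \<open>\<bar>f\<^sub>\<plusminus>'\<bar> \<le> M / r\<^sup>3\<close> with \<open>M\<close> independent of small \<open>B \<ge> 0\<close>; for small \<open>B\<close> the coupling term is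
  therefore dominated by the source, and the two equations can be treated separately.\<close>

section \<open>A maximum principle for cooperative systems\<close>

text \<open>Why divide by \<open>f\<close>: the equation of \<open>f'\<close> itself has the zeroth
  order coefficient \<open>V + 2 * A * f^2\<close> besides the angular part, and the potential
  \<open>V\<close> has no sign. As \<open>f\<close> is a positive solution with the same
  \<open>V\<close>, writing \<open>f' = f * p\<close> removes it. What remains is the form with
  entries A, B, A' in the variables \<open>f^2 * p\<close> and \<open>g^2 * q\<close>. For B > 0 and
  two nonzero degrees no choice of signs works: with p and q the coupling has the wrong sign, with p
  and -q the second source has. Coupling and source together are
  \<open>2 * f^2 / r^2 * (n^2 - B * r^3 * g * g')\<close>, which is why the decay exponent must be
  3. This is also the natural rate: the source in the equation of \<open>f'\<close> is
  \<open>2 * n^2 * f / r^3\<close>, and far out the zeroth order coefficient is bounded below. The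
  obstacle is uniformity in B. The limit f -> t only gives a radius that depends on the solution, so
  explicit barriers are used to find one radius beyond which \<open>f^2 >= t^2 / 2\<close> for all
  small B.\<close>

lemma right_derivative_nonneg_mono:
  fixes G :: "real \<Rightarrow> real"
  assumes ab: "a \<le> b" and cont: "continuous_on {a..b} G"
    and der: "\<And>x. a \<le> x \<Longrightarrow> x < b \<Longrightarrow> \<exists>d\<ge>0. (G has_real_derivative d) (at_right x)"
  shows "G a \<le> G b"
proof (rule field_le_epsilon)
  fix e :: real assume e: "e > 0"
  define \<eta> where "\<eta> = e / (b - a + 1)"
  have \<eta>: "\<eta> > 0" "\<eta> * (b - a) \<le> e"
    using e ab by (auto simp: \<eta>_def field_simps)
  \<comment> \<open>The tilt makes the right derivative strictly positive, so the last point
    \<open>c\<close> with \<open>H a <= H c\<close> could be moved further right if it were not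
    \<open>b\<close>.\<close>
  define H where "H = (\<lambda>y. G y + \<eta> * (y - a))"
  have contH: "continuous_on {a..b} H"
    unfolding H_def by (intro continuous_intros cont)
  have "H a \<le> H b"
  proof (rule ccontr)
    assume neg: "\<not> H a \<le> H b"
    define S where "S = {x \<in> {a..b}. H a \<le> H x}"
    have "closed S"
      unfolding S_def by (intro continuous_on_closed_Collect_le contH continuous_intros)
    moreover have "a \<in> S" "bdd_above S" using ab by (auto simp: S_def)
    ultimately have c: "Sup S \<in> S" by (intro closed_contains_Sup) auto
    define c where "c = Sup S"
    have c': "a \<le> c" "c < b" "H a \<le> H c"
      using c neg by (auto simp: S_def c_def less_le)
    obtain d where d: "d \<ge> 0" "(G has_real_derivative d) (at_right c)"
      using der c' by blast
    have "(H has_real_derivative (d + \<eta>)) (at_right c)"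
      unfolding H_def by (auto intro!: derivative_eq_intros d)
    then have "\<exists>\<delta>>0. \<forall>h>0. c + h \<in> {c<..} \<longrightarrow> h < \<delta> \<longrightarrow> H c < H (c + h)"
      using has_real_derivative_pos_inc_right d \<eta> by force
    then obtain \<delta> where \<delta>: "\<delta> > 0" "\<And>h. 0 < h \<Longrightarrow> h < \<delta> \<Longrightarrow> H c < H (c + h)" by auto
    define h where "h = min (\<delta>/2) (b - c)"
    have "0 < h" "h < \<delta>" "c + h \<le> b" using \<delta> c' by (auto simp: h_def min_def)
    then have "c + h \<in> S" using \<delta>(2)[of h] c' by (auto simp: S_def)
    then have "c + h \<le> c" unfolding c_def by (rule cSup_upper) (fact \<open>bdd_above S\<close>)
    then show False using \<open>0 < h\<close> by simp
  qed
  then show "G a \<le> G b + e" using \<eta> by (simp add: H_def)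
qed

text \<open>The truncation has a kink where \<open>p\<close> vanishes, so only right derivatives are
  available. There the difference quotients are those of \<open>p\<close> cut off at 0 and tend to
  \<open>min d 0\<close>. That the value is one of 0 and \<open>d\<close> later turns its product
  with the flux into a square.\<close>

lemma min_zero_right_derivative:
  fixes p :: "real \<Rightarrow> real"
  assumes "(p has_real_derivative d) (at x)"
  shows "\<exists>d'. ((\<lambda>y. min (p y) 0) has_real_derivative d') (at_right x) \<and>
    d' \<in> {0, d} \<and> (p x < 0 \<longrightarrow> d' = d)"
proof -
  have d: "(p has_real_derivative d) (at_right x)"
    using assms by (rule has_field_derivative_at_within)
  have "continuous (at x) p" using assms by (rule DERIV_isCont)
  then have lim: "(p \<longlongrightarrow> p x) (at_right x)"
    using filterlim_at_split isCont_def by blast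
  consider "p x < 0" | "p x > 0" | "p x = 0" by linarith
  then show ?thesis
  proof cases
    case 1
    have "\<forall>\<^sub>F y in at_right x. p y < 0" using order_tendstoD(2)[OF lim 1] .
    then have "\<forall>\<^sub>F y in at_right x. p y = min (p y) 0" by eventually_elim auto
    then have "((\<lambda>y. min (p y) 0) has_real_derivative d) (at_right x)"
      by (rule has_field_derivative_cong_eventually[THEN iffD1]) (use 1 d in simp_all)
    then show ?thesis by blast
  next
    case 2
    have "\<forall>\<^sub>F y in at_right x. p y > 0" using order_tendstoD(1)[OF lim 2] .
    then have "\<forall>\<^sub>F y in at_right x. 0 = min (p y) 0" by eventually_elim auto
    then have "((\<lambda>y. min (p y) 0) has_real_derivative 0) (at_right x)"
      by (rule has_field_derivative_cong_eventually[THEN iffD1]) (simp_all add: 2 less_imp_le min_absorb2)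
    then show ?thesis using 2 by (intro exI[of _ 0]) simp
  next
    case 3
    have "((\<lambda>y. (p y - p x) / (y - x)) \<longlongrightarrow> d) (at_right x)"
      using d by (simp add: has_field_derivative_iff)
    then have "((\<lambda>y. min ((p y - p x) / (y - x)) 0) \<longlongrightarrow> min d 0) (at_right x)"
      by (intro tendsto_min) auto
    moreover have "\<forall>\<^sub>F y in at_right x. min ((p y - p x) / (y - x)) 0 = (min (p y) 0 - min (p x) 0) / (y - x)"
      using eventually_at_right_less[of x]
      by eventually_elim (auto simp: 3 min_def field_simps)
    ultimately have "((\<lambda>y. (min (p y) 0 - min (p x) 0) / (y - x)) \<longlongrightarrow> min d 0) (at_right x)"
      by (rule Lim_transform_eventually)
    then have "((\<lambda>y. min (p y) 0) has_real_derivative min d 0) (at_right x)"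
      by (simp only: has_field_derivative_iff)
    moreover have "min d 0 \<in> {0, d}" by (simp add: min_def)
    ultimately show ?thesis using 3 by force
  qed
qed

text \<open>The smaller eigenvalue of a positive definite 2 by 2 matrix is at least determinant over
  trace, which is the choice of \<open>\<delta>\<close>. The shifted matrix then has determinant
  \<open>\<delta>^2\<close> and the positive entry \<open>A - \<delta>\<close>, so completing the
  square applies.\<close>

lemma quadratic_form_coercive:
  fixes A A' b :: real
  assumes "A > 0" "A' > 0" "b\<^sup>2 < A * A'"
  shows "\<exists>\<delta>>0. \<forall>x y. \<delta> * (x\<^sup>2 + y\<^sup>2) \<le> A * x\<^sup>2 + A' * y\<^sup>2 + 2 * b * x * y"
proof (intro exI conjI allI)
  define \<delta> where "\<delta> = (A * A' - b\<^sup>2) / (A + A')"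
  show \<delta>: "\<delta> > 0" using assms by (simp add: \<delta>_def)
  have "A * A' - b\<^sup>2 < A * (A + A')"
    using assms by (simp add: distrib_left add_strict_increasing2 zero_less_mult_iff)
      (smt (verit) mult_pos_pos zero_le_power2)
  then have a: "A - \<delta> > 0" using assms by (simp add: \<delta>_def field_simps)
  have "\<delta> * (A + A') = A * A' - b\<^sup>2" using assms by (simp add: \<delta>_def)
  then have "(A - \<delta>) * (A' - \<delta>) = b\<^sup>2 + \<delta>\<^sup>2" by (simp add: algebra_simps power2_eq_square)
  then have ge: "(A - \<delta>) * (A' - \<delta>) \<ge> b\<^sup>2" by simp
  fix x y
  have "(A - \<delta>) * ((A - \<delta>) * x\<^sup>2 + (A' - \<delta>) * y\<^sup>2 + 2 * b * x * y)
    = ((A - \<delta>) * x + b * y)\<^sup>2 + ((A - \<delta>) * (A' - \<delta>) - b\<^sup>2) * y\<^sup>2"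
    by (simp add: algebra_simps power2_eq_square)
  also have "\<dots> \<ge> 0" using ge by simp
  finally have "(A - \<delta>) * x\<^sup>2 + (A' - \<delta>) * y\<^sup>2 + 2 * b * x * y \<ge> 0"
    using a by (simp add: zero_le_mult_iff)
  then show "\<delta> * (x\<^sup>2 + y\<^sup>2) \<le> A * x\<^sup>2 + A' * y\<^sup>2 + 2 * b * x * y"
    by (simp add: algebra_simps)
qed

text \<open>No integrals are needed: with the negative parts as multipliers, the boundary term \<open>G\<close> of the
  integration by parts is nondecreasing, vanishes at \<open>0\<close>, and satisfies \<open>G \<le> C\<^sub>0 G'\<close> for large \<open>r\<close>,
  so that linear growth forces \<open>G = 0\<close>.\<close>

lemma cooperative_system_nonneg:
  fixes f g p q K J S T :: "real \<Rightarrow> real"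
  assumes A: "A > 0" "A' > 0" "b \<le> 0" "b\<^sup>2 < A * A'"
    and fpos: "\<And>r. r > 0 \<Longrightarrow> f r > 0" and gpos: "\<And>r. r > 0 \<Longrightarrow> g r > 0"
    and dp: "\<And>r. r > 0 \<Longrightarrow> (p has_real_derivative K r / (r * (f r)\<^sup>2)) (at r)"
    and dq: "\<And>r. r > 0 \<Longrightarrow> (q has_real_derivative J r / (r * (g r)\<^sup>2)) (at r)"
    and dK: "\<And>r. r > 0 \<Longrightarrow> (K has_real_derivative
        p r * (f r)\<^sup>2 / r + 2 * r * (f r)\<^sup>2 * (A * (f r)\<^sup>2 * p r + b * (g r)\<^sup>2 * q r) - S r) (at r)"
    and dJ: "\<And>r. r > 0 \<Longrightarrow> (J has_real_derivative
        q r * (g r)\<^sup>2 / r + 2 * r * (g r)\<^sup>2 * (A' * (g r)\<^sup>2 * q r + b * (f r)\<^sup>2 * p r) - T r) (at r)"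
    and S: "\<And>r. r > 0 \<Longrightarrow> S r \<ge> 0" and T: "\<And>r. r > 0 \<Longrightarrow> T r \<ge> 0"
    and zero: "((\<lambda>r. min (p r) 0 * K r) \<longlongrightarrow> 0) (at_right 0)"
      "((\<lambda>r. min (q r) 0 * J r) \<longlongrightarrow> 0) (at_right 0)"
    and \<kappa>: "\<kappa> > 0" "\<forall>\<^sub>F r in at_top. \<kappa> \<le> (f r)\<^sup>2" "\<forall>\<^sub>F r in at_top. \<kappa> \<le> (g r)\<^sup>2"
    and growth: "\<forall>\<^sub>F r in at_top. \<bar>p r * K r\<bar> \<le> C * r" "\<forall>\<^sub>F r in at_top. \<bar>q r * J r\<bar> \<le> C * r"
    and r: "r > 0"
  shows "p r \<ge> 0 \<and> q r \<ge> 0"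
proof -
  define m where "m = (\<lambda>r. min (p r) 0)"
  define l where "l = (\<lambda>r. min (q r) 0)"
  define G where "G = (\<lambda>r. m r * K r + l r * J r)"
  obtain \<delta> where \<delta>: "\<delta> > 0"
    "\<And>x y. \<delta> * (x\<^sup>2 + y\<^sup>2) \<le> A * x\<^sup>2 + A' * y\<^sup>2 + 2 * b * x * y"
    using quadratic_form_coercive[OF A(1,2,4)] by blast
  \<comment> \<open>The 1/2 pays for the share \<open>E / 2\<close> left by Young's inequality; the
    other summand converts \<open>x / 2 * ((X\<^sup>2 + Y\<^sup>2) / \<kappa>)\<close> into a
    multiple of the coercive part of \<open>D\<close>.\<close>
  define C0 where "C0 = 1/2 + 1 / (4 * \<delta> * \<kappa>)"
  have C0: "C0 > 0" using \<delta> \<kappa> by (simp add: C0_def add_pos_pos)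
  have key: "\<exists>D. (G has_real_derivative D) (at_right x) \<and>
      ((m x)\<^sup>2 * (f x)\<^sup>2 + (l x)\<^sup>2 * (g x)\<^sup>2) / x \<le> D \<and>
      (\<kappa> \<le> (f x)\<^sup>2 \<longrightarrow> \<kappa> \<le> (g x)\<^sup>2 \<longrightarrow> G x \<le> C0 * D)" if x: "x > 0" for x
  proof -
    obtain dm where dm: "(m has_real_derivative dm) (at_right x)"
      "dm \<in> {0, K x / (x * (f x)\<^sup>2)}" "p x < 0 \<longrightarrow> dm = K x / (x * (f x)\<^sup>2)"
      using min_zero_right_derivative[OF dp[OF x]] unfolding m_def by blast
    obtain dl where dl: "(l has_real_derivative dl) (at_right x)"
      "dl \<in> {0, J x / (x * (g x)\<^sup>2)}" "q x < 0 \<longrightarrow> dl = J x / (x * (g x)\<^sup>2)"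
      using min_zero_right_derivative[OF dq[OF x]] unfolding l_def by blast
    define K' where "K' = p x * (f x)\<^sup>2 / x + 2 * x * (f x)\<^sup>2 * (A * (f x)\<^sup>2 * p x + b * (g x)\<^sup>2 * q x) - S x"
    define J' where "J' = q x * (g x)\<^sup>2 / x + 2 * x * (g x)\<^sup>2 * (A' * (g x)\<^sup>2 * q x + b * (f x)\<^sup>2 * p x) - T x"
    define D where "D = (dm * K x + K' * m x) + (dl * J x + J' * l x)"
    have fx: "f x > 0" "g x > 0" using fpos gpos x by auto
    have D: "(G has_real_derivative D) (at_right x)"
      unfolding G_def D_def K'_def J'_def
      by (intro DERIV_add DERIV_mult dm dl has_field_derivative_at_within[OF dK[OF x]]
          has_field_derivative_at_within[OF dJ[OF x]])
    \<comment> \<open>Whichever of its two values \<open>dm\<close> takes, the product with the flux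
      is the Dirichlet energy density of the truncation; likewise for \<open>dl\<close>.\<close>
    have 1: "dm * K x = x * (f x)\<^sup>2 * dm\<^sup>2" "dl * J x = x * (g x)\<^sup>2 * dl\<^sup>2"
      using dm(2) dl(2) fx x by (auto simp: power2_eq_square)
    have 2: "m x * K x = x * (f x)\<^sup>2 * (m x * dm)" "l x * J x = x * (g x)\<^sup>2 * (l x * dl)"
      using dm(3) dl(3) fx x by (auto simp: m_def l_def min_def)
    have sgn: "m x \<le> 0" "l x \<le> 0" "m x \<le> p x" "l x \<le> q x"
       "p x * m x = (m x)\<^sup>2" "q x * l x = (l x)\<^sup>2"
      by (auto simp: m_def l_def min_def power2_eq_square)
    \<comment> \<open>Cooperativity: since \<open>b <= 0\<close> and \<open>m x <= 0\<close>,
      replacing \<open>q x\<close> by its negative part can only lower the coupling term.\<close>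
    have cross: "b * (m x * l x) \<le> b * (q x * m x)" "b * (m x * l x) \<le> b * (p x * l x)"
      using mult_left_mono_neg[OF mult_left_mono_neg[OF sgn(4) sgn(1)] A(3)]
        mult_left_mono_neg[OF mult_left_mono_neg[OF sgn(3) sgn(2)] A(3)] by (simp_all add: mult_ac)
    \<comment> \<open>In these variables the zeroth order terms form exactly the coercive quadratic
      form.\<close>
    define X where "X = (f x)\<^sup>2 * m x"
    define Y where "Y = (g x)\<^sup>2 * l x"
    have K': "K' * m x \<ge> (m x)\<^sup>2 * (f x)\<^sup>2 / x + 2 * x * (A * X\<^sup>2 + b * X * Y)"
    proof -
      have "K' * m x = (p x * m x) * (f x)\<^sup>2 / x + 2 * x * (A * (f x)^4 * (p x * m x) + (f x)\<^sup>2 * (g x)\<^sup>2 * (b * (q x * m x))) - S x * m x"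
        by (simp add: K'_def algebra_simps power2_eq_square power4_eq_xxxx)
      moreover have "x * ((f x)\<^sup>2 * (g x)\<^sup>2 * (b * (m x * l x))) \<le> x * ((f x)\<^sup>2 * (g x)\<^sup>2 * (b * (q x * m x)))"
        by (rule mult_left_mono[OF mult_left_mono]) (use x cross in auto)
      moreover have "S x * m x \<le> 0" using S[OF x] sgn by (simp add: mult_nonneg_nonpos)
      ultimately show ?thesis unfolding sgn by (simp add: X_def Y_def algebra_simps power2_eq_square power4_eq_xxxx)
    qed
    have J': "J' * l x \<ge> (l x)\<^sup>2 * (g x)\<^sup>2 / x + 2 * x * (A' * Y\<^sup>2 + b * X * Y)"
    proof -
      have "J' * l x = (q x * l x) * (g x)\<^sup>2 / x + 2 * x * (A' * (g x)^4 * (q x * l x) + (f x)\<^sup>2 * (g x)\<^sup>2 * (b * (p x * l x))) - T x * l x"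
        by (simp add: J'_def algebra_simps power2_eq_square power4_eq_xxxx)
      moreover have "x * ((f x)\<^sup>2 * (g x)\<^sup>2 * (b * (m x * l x))) \<le> x * ((f x)\<^sup>2 * (g x)\<^sup>2 * (b * (p x * l x)))"
        by (rule mult_left_mono[OF mult_left_mono]) (use x cross in auto)
      moreover have "T x * l x \<le> 0" using T[OF x] sgn by (simp add: mult_nonneg_nonpos)
      ultimately show ?thesis unfolding sgn by (simp add: X_def Y_def algebra_simps power2_eq_square power4_eq_xxxx)
    qed
    define E where "E = x * ((f x)\<^sup>2 * dm\<^sup>2 + (g x)\<^sup>2 * dl\<^sup>2)"
    have E: "E \<ge> 0" using x by (simp add: E_def)
    define M where "M = ((m x)\<^sup>2 * (f x)\<^sup>2 + (l x)\<^sup>2 * (g x)\<^sup>2) / x"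
    have M: "M \<ge> 0" using x by (simp add: M_def)
    have XY: "0 \<le> \<delta> * (X\<^sup>2 + Y\<^sup>2)" using \<delta> by simp
    have "2 * x * (\<delta> * (X\<^sup>2 + Y\<^sup>2)) \<le> 2 * x * (A * X\<^sup>2 + A' * Y\<^sup>2 + 2 * b * X * Y)"
      using x \<delta> by (intro mult_left_mono) auto
    \<comment> \<open>Energy inequality: \<open>E\<close> is the gradient part, \<open>M\<close>
      comes from the terms \<open>p * f^2 / r\<close> and \<open>q * g^2 / r\<close>, and the last
      summand from coercivity; the sources only help.\<close>
    then have DE: "D \<ge> E + M + 2 * x * (\<delta> * (X\<^sup>2 + Y\<^sup>2))"
      using K' J' unfolding D_def 1 E_def M_def by (simp add: algebra_simps add_divide_distrib)
    have DM: "M \<le> D" using DE E x XY by (smt (verit) mult_nonneg_nonneg)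
    have "G x \<le> C0 * D" if "\<kappa> \<le> (f x)\<^sup>2" "\<kappa> \<le> (g x)\<^sup>2"
    proof -
      have "m x * dm \<le> ((m x)\<^sup>2 + dm\<^sup>2) / 2" "l x * dl \<le> ((l x)\<^sup>2 + dl\<^sup>2) / 2"
        using sum_squares_bound[of "m x" dm] sum_squares_bound[of "l x" dl] by auto
      then have "G x \<le> x * (f x)\<^sup>2 * (((m x)\<^sup>2 + dm\<^sup>2) / 2) + x * (g x)\<^sup>2 * (((l x)\<^sup>2 + dl\<^sup>2) / 2)"
        unfolding G_def 2 using x by (intro add_mono mult_left_mono) auto
      also have "\<dots> = E / 2 + x / 2 * ((f x)\<^sup>2 * (m x)\<^sup>2 + (g x)\<^sup>2 * (l x)\<^sup>2)"
        by (simp add: E_def algebra_simps add_divide_distrib)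
      also have "\<dots> \<le> E / 2 + x / 2 * ((X\<^sup>2 + Y\<^sup>2) / \<kappa>)"
      proof -
        have "\<kappa> * ((f x)\<^sup>2 * (m x)\<^sup>2) \<le> X\<^sup>2" "\<kappa> * ((g x)\<^sup>2 * (l x)\<^sup>2) \<le> Y\<^sup>2"
          using mult_right_mono[OF that(1) mult_nonneg_nonneg[OF zero_le_power2 zero_le_power2], of "f x" "m x"]
            mult_right_mono[OF that(2) mult_nonneg_nonneg[OF zero_le_power2 zero_le_power2], of "g x" "l x"]
          by (simp_all add: X_def Y_def power_mult_distrib power2_eq_square mult_ac)
        then have "(f x)\<^sup>2 * (m x)\<^sup>2 + (g x)\<^sup>2 * (l x)\<^sup>2 \<le> (X\<^sup>2 + Y\<^sup>2) / \<kappa>"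
          using \<kappa>(1) by (simp add: pos_le_divide_eq algebra_simps)
        then show ?thesis using x by (intro add_left_mono mult_left_mono) auto
      qed
      also have "x / 2 * ((X\<^sup>2 + Y\<^sup>2) / \<kappa>) = 1 / (4 * \<delta> * \<kappa>) * (2 * x * (\<delta> * (X\<^sup>2 + Y\<^sup>2)))"
        using \<delta> \<kappa> by (simp add: field_simps)
      also have "E / 2 + \<dots> \<le> C0 * E + C0 * (2 * x * (\<delta> * (X\<^sup>2 + Y\<^sup>2)))"
      proof (intro add_mono mult_right_mono)
        show "E / 2 \<le> C0 * E" using mult_right_mono[of "1/2" C0 E] E \<delta> \<kappa> by (simp add: C0_def)
        show "1 / (4 * \<delta> * \<kappa>) \<le> C0" by (simp add: C0_def)
        show "0 \<le> 2 * x * (\<delta> * (X\<^sup>2 + Y\<^sup>2))" using x XY by simp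
      qed
      also have "\<dots> \<le> C0 * D"
        using DE M C0 by (simp flip: distrib_left)
      finally show ?thesis .
    qed
    then show ?thesis using D DM unfolding M_def by blast
  qed
  have cont: "continuous_on {a..b} G" if "a > 0" for a b
  proof -
    have "isCont p x" "isCont q x" "isCont K x" "isCont J x" if "x > 0" for x
      using DERIV_isCont dp dq dK dJ that by blast+
    then show ?thesis using \<open>a > 0\<close> unfolding G_def m_def l_def
      by (intro continuous_at_imp_continuous_on ballI continuous_intros) auto
  qed
  have mono: "G a \<le> G b" if "0 < a" "a \<le> b" for a b
  proof (rule right_derivative_nonneg_mono[OF that(2) cont[OF that(1)]])
    fix x assume x: "a \<le> x" "x < b"
    then have "x > 0" using that by simp
    from key[OF this] obtain D where "(G has_real_derivative D) (at_right x)"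
      "((m x)\<^sup>2 * (f x)\<^sup>2 + (l x)\<^sup>2 * (g x)\<^sup>2) / x \<le> D" by blast
    moreover have "0 \<le> ((m x)\<^sup>2 * (f x)\<^sup>2 + (l x)\<^sup>2 * (g x)\<^sup>2) / x" using \<open>x > 0\<close> by simp
    ultimately show "\<exists>d\<ge>0. (G has_real_derivative d) (at_right x)"
      by (intro exI[of _ D]) auto
  qed
  have G_ge: "G a \<ge> 0" if "a > 0" for a
  proof (rule tendsto_upperbound)
    show "(G \<longlongrightarrow> 0) (at_right 0)"
      using tendsto_add[OF zero] by (simp add: G_def m_def l_def)
    show "\<forall>\<^sub>F x in at_right 0. G x \<le> G a"
      using eventually_at_right_real[OF that] by eventually_elim (auto intro: mono)
  qed auto
  obtain R where R: "R > 0" "\<And>x. x \<ge> R \<Longrightarrow> \<kappa> \<le> (f x)\<^sup>2 \<and> \<kappa> \<le> (g x)\<^sup>2 \<and> \<bar>p x * K x\<bar> \<le> C * x \<and> \<bar>q x * J x\<bar> \<le> C * x"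
  proof -
    have "\<forall>\<^sub>F x in at_top. (0::real) < x \<and> \<kappa> \<le> (f x)\<^sup>2 \<and> \<kappa> \<le> (g x)\<^sup>2 \<and> \<bar>p x * K x\<bar> \<le> C * x \<and> \<bar>q x * J x\<bar> \<le> C * x"
      using \<kappa> growth eventually_gt_at_top by (auto simp: eventually_conj_iff)
    then show ?thesis using that unfolding eventually_at_top_linorder by (metis order_refl)
  qed
  have G_le: "G a \<le> 0" if "a > 0" for a
  proof -
    have aR: "G a \<le> G (max a R)" using that by (intro mono) auto
    define c where "c = max a R"
    have c: "c > 0" "c \<ge> R" using that by (auto simp: c_def)
    have ex: "exp (- c / C0) * G c \<le> exp (- y / C0) * G y" if "c \<le> y" for y
    proof (rule right_derivative_nonneg_mono[OF that])
      show "continuous_on {c..y} (\<lambda>x. exp (- x / C0) * G x)"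
        by (intro continuous_intros cont c) (use C0 in auto)
      fix x assume x: "c \<le> x" "x < y"
      then have "x > 0" using c by simp
      from key[OF this] R(2)[of x] x c obtain D where D: "(G has_real_derivative D) (at_right x)" "G x \<le> C0 * D"
        by (metis order_trans)
      have "((\<lambda>x. exp (- x / C0) * G x) has_real_derivative exp (- x / C0) * (D - G x / C0)) (at_right x)"
        using C0 by (auto intro!: derivative_eq_intros D) (simp add: field_simps)
      moreover have "D - G x / C0 \<ge> 0" using D C0 by (simp add: field_simps)
      ultimately show "\<exists>d\<ge>0. ((\<lambda>x. exp (- x / C0) * G x) has_real_derivative d) (at_right x)"
        by (meson exp_ge_zero mult_nonneg_nonneg)
    qed
    have "exp (- c / C0) * G c \<le> 0"
    proof (rule tendsto_lowerbound)
      have "((\<lambda>y. (y / C0) * exp (- (y / C0))) \<longlongrightarrow> 0) at_top"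
      proof -
        have "((\<lambda>y::real. y ^ 1 / exp y) \<longlongrightarrow> 0) at_top" by (rule tendsto_power_div_exp_0)
        then have "((\<lambda>y::real. (y / C0) ^ 1 / exp (y / C0)) \<longlongrightarrow> 0) at_top"
          by (rule filterlim_compose) (use C0 in \<open>auto intro!: filterlim_at_top_mult_tendsto_pos[of _ "1/C0"] simp: divide_inverse filterlim_ident\<close>)
        then show ?thesis by (simp add: exp_minus field_simps)
      qed
      then show "((\<lambda>y. 2 * C * C0 * ((y / C0) * exp (- (y / C0)))) \<longlongrightarrow> 0) at_top"
        by (rule tendsto_mult_right_zero)
      show "\<forall>\<^sub>F y in at_top. exp (- c / C0) * G c \<le> 2 * C * C0 * ((y / C0) * exp (- (y / C0)))"
        using eventually_ge_at_top[of c]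
      proof eventually_elim
        case (elim y)
        then have y: "y \<ge> R" "y > 0" using c by auto
        have "m y * K y \<le> C * y" "l y * J y \<le> C * y"
          using R(2)[OF y(1)] by (auto simp: m_def l_def min_def)
        then have "G y \<le> 2 * C * y" by (simp add: G_def)
        then have "exp (- y / C0) * G y \<le> exp (- y / C0) * (2 * C * y)"
          by (intro mult_left_mono) auto
        with ex[OF elim] have "exp (- c / C0) * G c \<le> exp (- y / C0) * (2 * C * y)" by linarith
        then show ?case using C0 by (simp add: mult_ac)
      qed
    qed auto
    then have "G c \<le> 0" by (simp add: mult_le_0_iff)
    then show ?thesis using aR by (simp add: c_def)
  qed
  have G0: "G x = 0" if "x > 0" for x using G_ge[OF that] G_le[OF that] by simp
  from key[OF r] obtain D where D: "(G has_real_derivative D) (at_right r)"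
    "((m r)\<^sup>2 * (f r)\<^sup>2 + (l r)\<^sup>2 * (g r)\<^sup>2) / r \<le> D" by blast
  \<comment> \<open>\<open>G\<close> vanishes identically, hence \<open>D = 0\<close>. As
    \<open>D\<close> dominates the squares of \<open>m * f\<close> and \<open>l * g\<close>, both
    truncations vanish.\<close>
  have "((\<lambda>_. 0) has_real_derivative D) (at_right r)"
  proof (subst has_field_derivative_cong_eventually)
    show "\<forall>\<^sub>F x in at_right r. 0 = G x"
      using eventually_at_right_less[of r] by eventually_elim (use r G0 in auto)
  qed (use D r G0 in auto)
  moreover have "((\<lambda>_. 0::real) has_real_derivative 0) (at_right r)" by auto
  ultimately have "D = 0"
    by (metis has_real_derivative_iff_has_vector_derivative trivial_limit_at_right_real vector_derivative_unique_within)
  with D(2) have "(m r)\<^sup>2 * (f r)\<^sup>2 + (l r)\<^sup>2 * (g r)\<^sup>2 \<le> 0" using r by (simp add: field_simps)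
  then have "(m r * f r)\<^sup>2 + (l r * g r)\<^sup>2 \<le> 0" by (simp add: power_mult_distrib)
  then have "m r * f r = 0 \<and> l r * g r = 0" by (simp add: sum_power2_le_zero_iff)
  then show ?thesis using fpos[OF r] gpos[OF r] by (auto simp: m_def l_def min_def split: if_splits)
qed

section \<open>One component of a solution\<close>

text \<open>If the bound failed, \<open>f'\<close> would lie below \<open>- D - c / r\<close> near \<open>0\<close>, and \<open>f\<close> would blow up
  logarithmically.\<close>

lemma deriv_lower_bound_near_zero:
  fixes f u e :: "real \<Rightarrow> real"
  assumes df: "\<And>r. 0 < r \<Longrightarrow> r \<le> R \<Longrightarrow> (f has_real_derivative u r) (at r)"
    and dru: "\<And>r. 0 < r \<Longrightarrow> r \<le> R \<Longrightarrow> ((\<lambda>r. r * u r) has_real_derivative e r) (at r)"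
    and e: "\<And>r. 0 < r \<Longrightarrow> r \<le> R \<Longrightarrow> e r \<ge> - D"
    and bdd: "\<And>r. 0 < r \<Longrightarrow> r \<le> R \<Longrightarrow> f r \<le> F"
    and r: "0 < r" "r \<le> R"
  shows "u r \<ge> - D"
proof (rule ccontr)
  assume neg: "\<not> u r \<ge> - D"
  define c where "c = - (r * u r + D * r)"
  have "c = r * (- D - u r)" by (simp add: c_def algebra_simps)
  then have c: "c > 0" using neg r by simp
  have ru: "x * u x + D * x \<le> - c" if x: "0 < x" "x \<le> r" for x
  proof -
    have "x * u x + D * x \<le> r * u r + D * r"
    proof (rule DERIV_nonneg_imp_nondecreasing[OF x(2)])
      fix y assume y: "x \<le> y" "y \<le> r"
      have "((\<lambda>y. y * u y + D * y) has_real_derivative e y + D) (at y)"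
        using x y r by (auto intro!: DERIV_add DERIV_cmult_Id dru)
      then show "\<exists>d. ((\<lambda>y. y * u y + D * y) has_real_derivative d) (at y) \<and> 0 \<le> d"
        using e[of y] x y r by force
    qed
    then show ?thesis by (simp add: c_def)
  qed
  have f: "f r + D * r + c * (ln r - ln x) \<le> f x + D * x" if x: "0 < x" "x \<le> r" for x
  proof -
    have "f r + D * r + c * ln r \<le> f x + D * x + c * ln x"
    proof (rule DERIV_nonpos_imp_nonincreasing[OF x(2)])
      fix y assume y: "x \<le> y" "y \<le> r"
      have "((\<lambda>y. f y + D * y + c * ln y) has_real_derivative u y + D + c / y) (at y)"
        using x y r by (auto intro!: derivative_eq_intros df)
      moreover have "u y + D + c / y = (y * u y + D * y + c) / y" using x y by (simp add: field_simps)
      moreover have "\<dots> \<le> 0" using ru[of y] x y by (simp add: divide_nonpos_pos)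
      ultimately show "\<exists>d. ((\<lambda>y. f y + D * y + c * ln y) has_real_derivative d) (at y) \<and> d \<le> 0"
        by auto
    qed
    then show ?thesis by (simp add: algebra_simps)
  qed
  \<comment> \<open>Chosen so that at the point \<open>x\<close> below, the logarithmic term lifts
    \<open>f x\<close> above its bound \<open>F\<close>; the summand
    \<open>\<bar>D\<bar> * r\<close> absorbs the linear correction and 1 gives strictness.\<close>
  define L where "L = (F + \<bar>D\<bar> * r - f r - D * r + 1) / c"
  define x where "x = min r (exp (ln r - L))"
  have x: "0 < x" "x \<le> r" using r by (auto simp: x_def)
  have "ln x \<le> ln r - L" using r by (metis exp_gt_zero ln_exp ln_le_cancel_iff min.cobounded2 x(1) x_def)
  then have "c * L \<le> c * (ln r - ln x)" using c by (intro mult_left_mono) auto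
  then have "F + \<bar>D\<bar> * r + 1 \<le> f x + D * x" using f[OF x] c by (simp add: L_def)
  moreover have "D * x \<le> \<bar>D\<bar> * x" using x by (intro mult_right_mono) auto
  moreover have "\<bar>D\<bar> * x \<le> \<bar>D\<bar> * r" using x by (intro mult_left_mono) auto
  ultimately show False using bdd[of x] x r by linarith
qed

text \<open>Gronwall for the energy \<open>f^2 + u^2\<close>: the damping term \<open>a\<close> only
  decreases it, and the remaining growth rate is at most \<open>1 + Q\<close>, because
  \<open>2 * \<bar>f * u\<bar> <= f^2 + u^2\<close>.\<close>

lemma linear_ode_zero:
  fixes f u a c :: "real \<Rightarrow> real"
  assumes df: "\<And>x. r \<le> x \<Longrightarrow> x \<le> b \<Longrightarrow> (f has_real_derivative u x) (at x)"
    and du: "\<And>x. r \<le> x \<Longrightarrow> x \<le> b \<Longrightarrow> (u has_real_derivative c x * f x - a x * u x) (at x)"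
    and a: "\<And>x. r \<le> x \<Longrightarrow> x \<le> b \<Longrightarrow> a x \<ge> 0"
    and c: "\<And>x. r \<le> x \<Longrightarrow> x \<le> b \<Longrightarrow> \<bar>c x\<bar> \<le> Q"
    and init: "f r = 0" "u r = 0" and rb: "r \<le> b"
  shows "f b = 0"
proof -
  define k where "k = 1 + Q"
  have "((f b)\<^sup>2 + (u b)\<^sup>2) * exp (- k * b) \<le> ((f r)\<^sup>2 + (u r)\<^sup>2) * exp (- k * r)"
  proof (rule DERIV_nonpos_imp_nonincreasing[OF rb])
    fix x assume x: "r \<le> x" "x \<le> b"
    let ?D = "(2 * f x * u x + 2 * u x * (c x * f x - a x * u x) - k * ((f x)\<^sup>2 + (u x)\<^sup>2)) * exp (- k * x)"
    have "((\<lambda>x. ((f x)\<^sup>2 + (u x)\<^sup>2) * exp (- k * x)) has_real_derivative ?D) (at x)"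
      by (auto intro!: derivative_eq_intros df[OF x] du[OF x]) (simp add: algebra_simps)
    moreover have "2 * f x * u x + 2 * u x * (c x * f x - a x * u x) \<le> k * ((f x)\<^sup>2 + (u x)\<^sup>2)"
    proof -
      have "2 * (f x * u x) * (1 + c x) \<le> \<bar>2 * (f x * u x)\<bar> * \<bar>1 + c x\<bar>"
        by (metis abs_ge_self abs_mult)
      also have "\<dots> \<le> ((f x)\<^sup>2 + (u x)\<^sup>2) * k"
      proof (rule mult_mono)
        show "\<bar>2 * (f x * u x)\<bar> \<le> (f x)\<^sup>2 + (u x)\<^sup>2"
          using sum_squares_bound[of "f x" "u x"] sum_squares_bound[of "f x" "- u x"] by (simp add: abs_le_iff)
        show "\<bar>1 + c x\<bar> \<le> k" using c[OF x] by (simp add: k_def)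
      qed auto
      moreover have "a x * (u x)\<^sup>2 \<ge> 0" using a[OF x] by simp
      ultimately show ?thesis by (simp add: algebra_simps power2_eq_square)
    qed
    then have "?D \<le> 0" by (simp add: mult_le_0_iff)
    ultimately show "\<exists>d. ((\<lambda>x. ((f x)\<^sup>2 + (u x)\<^sup>2) * exp (- k * x)) has_real_derivative d) (at x) \<and> d \<le> 0"
      by blast
  qed
  then have "(f b)\<^sup>2 + (u b)\<^sup>2 \<le> 0" by (simp add: init mult_le_0_iff)
  then show ?thesis by (simp add: sum_power2_le_zero_iff)
qed

text \<open>Exchanging \<open>f\<close> and \<open>g\<close> exchanges the two equations, so a single equation with given \<open>g\<close> is
  studied first.\<close>

locale radial_component =
  fixes A t B s :: real and n :: int and f g :: "real \<Rightarrow> real"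
  assumes equation: "radial_equation A t B s n f g"
    and boundary: "radial_boundary_conditions n t f"
    and t_pos: "t > 0"
    and g_differentiable: "\<And>r. r > 0 \<Longrightarrow> g differentiable (at r)"
    and g_continuous: "continuous_on {0..} g"
    and g_limit: "(g \<longlongrightarrow> s) at_top"
begin

text \<open>With the bracket regarded as a given potential, \<open>f\<close> solves a linear
  equation. This linearity carries the positivity argument and later allows multiples of
  \<open>f\<close> in comparisons.\<close>

definition V :: "real \<Rightarrow> real" where
  "V r = A * ((f r)\<^sup>2 - t\<^sup>2) + B * ((g r)\<^sup>2 - s\<^sup>2)"

text \<open>This is \<open>r f\<^sup>2 (f' / f)'\<close> with \<open>f''\<close> eliminated by means of the equation.\<close>

definition K :: "real \<Rightarrow> real" where
  "K r = ((of_int n)\<^sup>2 / r + r * V r) * (f r)\<^sup>2 - deriv f r * f r - r * (deriv f r)\<^sup>2"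

lemma f_nonneg: "r \<ge> 0 \<Longrightarrow> f r \<ge> 0"
  and f_continuous: "continuous_on {0..} f"
  and f_limit: "(f \<longlongrightarrow> t) at_top"
  and f_zero: "n \<noteq> 0 \<Longrightarrow> f 0 = 0"
  using boundary by (auto simp: radial_boundary_conditions_def)

lemma df: "r > 0 \<Longrightarrow> (f has_real_derivative deriv f r) (at r)"
  using equation by (auto simp: radial_equation_def real_differentiable_def dest: DERIV_imp_deriv)

lemma dg: "r > 0 \<Longrightarrow> (g has_real_derivative deriv g r) (at r)"
  using g_differentiable by (auto simp: real_differentiable_def dest: DERIV_imp_deriv)

lemma ddf:
  assumes "r > 0"
  shows "(deriv f has_real_derivative ((of_int n)\<^sup>2 / r\<^sup>2 + V r) * f r - deriv f r / r) (at r)"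
proof -
  have "deriv f differentiable (at r)"
    and eq: "- deriv (deriv f) r - 1 / r * deriv f r + (of_int n)\<^sup>2 / r\<^sup>2 * f r + V r * f r = 0"
    using equation assms by (auto simp: radial_equation_def V_def)
  then have "(deriv f has_real_derivative deriv (deriv f) r) (at r)"
    by (auto simp: real_differentiable_def dest: DERIV_imp_deriv)
  moreover have "deriv (deriv f) r = ((of_int n)\<^sup>2 / r\<^sup>2 + V r) * f r - deriv f r / r"
    using eq by (simp add: algebra_simps)
  ultimately show ?thesis by simp
qed

lemma dru: "r > 0 \<Longrightarrow> ((\<lambda>r. r * deriv f r) has_real_derivative ((of_int n)\<^sup>2 / r + r * V r) * f r) (at r)"
  by (auto intro!: derivative_eq_intros ddf) (simp add: field_simps power2_eq_square)

lemma dV: "r > 0 \<Longrightarrow> (V has_real_derivative 2 * A * f r * deriv f r + 2 * B * g r * deriv g r) (at r)"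
  unfolding V_def[abs_def] by (auto intro!: derivative_eq_intros df dg)

lemma V_continuous: "continuous_on {0..} V"
  unfolding V_def[abs_def] by (intro continuous_intros f_continuous g_continuous)

lemma V_limit: "(V \<longlongrightarrow> 0) at_top"
proof -
  have "(V \<longlongrightarrow> A * (t\<^sup>2 - t\<^sup>2) + B * (s\<^sup>2 - s\<^sup>2)) at_top"
    unfolding V_def[abs_def] by (intro tendsto_intros f_limit g_limit)
  then show ?thesis by simp
qed

section \<open>Positivity of the profile, including the origin for degree zero\<close>

lemma bounded_on_interval: "\<exists>D\<ge>0. \<forall>x\<in>{0..b}. \<bar>V x\<bar> \<le> D \<and> \<bar>f x\<bar> \<le> D"
proof -
  have "compact ((\<lambda>x. \<bar>V x\<bar> + \<bar>f x\<bar>) ` {0..b})"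
    by (intro compact_continuous_image continuous_intros continuous_on_subset[OF V_continuous]
        continuous_on_subset[OF f_continuous]) auto
  then obtain D where "\<forall>x\<in>{0..b}. \<bar>V x\<bar> + \<bar>f x\<bar> \<le> D"
    by (auto dest!: compact_imp_bounded simp: bounded_real)
  then show ?thesis by (intro exI[of _ "\<bar>D\<bar>"]) force
qed

text \<open>A zero of the nonnegative \<open>f\<close> is a minimum, so \<open>f'\<close> vanishes
  there too. Uniqueness for the linear equation then gives \<open>f = 0\<close> from that point on,
  against the limit \<open>t > 0\<close>.\<close>

lemma f_pos:
  assumes r: "r > 0"
  shows "f r > 0"
proof (rule ccontr)
  assume "\<not> f r > 0"
  then have fr: "f r = 0" using f_nonneg[of r] r by simp
  have "deriv f r = 0"
  proof (rule DERIV_local_min[OF df[OF r] r])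
    show "\<forall>y. \<bar>r - y\<bar> < r \<longrightarrow> f r \<le> f y" using f_nonneg r by (auto simp: fr)
  qed
  have "f b = 0" if b: "b \<ge> r" for b
  proof -
    obtain D where D: "\<forall>x\<in>{0..b}. \<bar>V x\<bar> \<le> D \<and> \<bar>f x\<bar> \<le> D" using bounded_on_interval by blast
    show ?thesis
    proof (rule linear_ode_zero[where f = f and u = "deriv f" and r = r and
          c = "\<lambda>r. (of_int n)\<^sup>2 / r\<^sup>2 + V r" and a = "\<lambda>r. 1 / r" and Q = "(of_int n)\<^sup>2 / r\<^sup>2 + D"])
      fix x assume x: "r \<le> x" "x \<le> b"
      show "(f has_real_derivative deriv f x) (at x)" using x r by (intro df) simp
      show "(deriv f has_real_derivative ((of_int n)\<^sup>2 / x\<^sup>2 + V x) * f x - 1 / x * deriv f x) (at x)"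
        using ddf[of x] x r by simp
      show "0 \<le> 1 / x" using x r by simp
      have "(of_int n)\<^sup>2 / x\<^sup>2 \<le> (of_int n)\<^sup>2 / r\<^sup>2" "0 \<le> (of_int n)\<^sup>2 / x\<^sup>2" using x r
        by (auto intro!: divide_left_mono power_mono)
      moreover have "\<bar>V x\<bar> \<le> D" using D x r by auto
      ultimately show "\<bar>(of_int n)\<^sup>2 / x\<^sup>2 + V x\<bar> \<le> (of_int n)\<^sup>2 / r\<^sup>2 + D" by linarith
    qed fact+
  qed
  then have "\<forall>\<^sub>F b in at_top. f b = 0" using eventually_ge_at_top[of r] by (rule eventually_mono[rotated])
  moreover have "\<forall>\<^sub>F b in at_top. f b > 0" using order_tendstoD(1)[OF f_limit t_pos] .
  ultimately have "\<forall>\<^sub>F b::real in at_top. False" by eventually_elim simp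
  then show False by simp
qed

text \<open>The equation is singular at 0, so \<open>linear_ode_zero\<close> cannot start there. If
  \<open>f 0 = 0\<close>, the maximum of \<open>f\<close> on \<open>{0..b}\<close> lies at some
  \<open>x > 0\<close>. The divergence form bounds \<open>f'\<close> by \<open>D * f x\<close>, and
  the mean value theorem yields \<open>f x <= b * D * f x\<close>, which is absurd because
  \<open>b\<close> was chosen with \<open>b * D < 1\<close>.\<close>

lemma f_zero_pos:
  assumes n: "n = 0"
  shows "f 0 > 0"
proof (rule ccontr)
  assume "\<not> f 0 > 0"
  then have f0: "f 0 = 0" using f_nonneg[of 0] by simp
  obtain D where D: "D \<ge> 0" "\<forall>x\<in>{0..1}. \<bar>V x\<bar> \<le> D \<and> \<bar>f x\<bar> \<le> D" using bounded_on_interval by blast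
  define b where "b = 1 / (1 + D)"
  have b: "0 < b" "b \<le> 1" "b * D < 1" using D by (auto simp: b_def field_simps)
  obtain x where x: "x \<in> {0..b}" "\<And>y. y \<in> {0..b} \<Longrightarrow> f y \<le> f x"
    using continuous_attains_sup[of "{0..b}" f] b continuous_on_subset[OF f_continuous] by force
  have "f x > 0" using x(2)[of b] f_pos[of b] b by auto
  then have x0: "x > 0" using x f0 by (cases "x = 0") auto
  have u: "deriv f r \<le> D * f x" if r: "0 < r" "r \<le> b" for r
  proof -
    have "- deriv f r \<ge> - (D * f x)"
    proof (rule deriv_lower_bound_near_zero[where R = b and f = "\<lambda>r. - f r" and u = "\<lambda>r. - deriv f r" and F = 0 and e = "\<lambda>r. - (r * V r * f r)"])
      fix y assume y: "0 < y" "y \<le> b"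
      show "((\<lambda>r. - f r) has_real_derivative - deriv f y) (at y)" using df y by (auto intro: derivative_intros)
      show "((\<lambda>r. r * - deriv f r) has_real_derivative - (y * V y * f y)) (at y)"
        using dru[OF y(1)] n by (auto dest: DERIV_minus)
      have "y * \<bar>V y\<bar> \<le> 1 * D" using D y b by (intro mult_mono) auto
      then have "y * \<bar>V y\<bar> * f y \<le> D * f x" using x y D f_nonneg by (intro mult_mono) auto
      moreover have "y * V y * f y \<le> y * \<bar>V y\<bar> * f y" using y f_nonneg by (intro mult_left_mono mult_right_mono) auto
      ultimately show "- (D * f x) \<le> - (y * V y * f y)" by simp
      show "- f y \<le> 0" using y f_nonneg by simp
    qed fact+
    then show ?thesis by simp
  qed
  obtain z where z: "0 < z" "z < x" "f x - f 0 = (x - 0) * deriv f z"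
  proof -
    have "\<exists>l z. 0 < z \<and> z < x \<and> DERIV f z :> l \<and> f x - f 0 = (x - 0) * l"
      using x0 x df by (intro MVT continuous_on_subset[OF f_continuous]) (auto simp: real_differentiable_def)
    then show ?thesis using that by (metis DERIV_imp_deriv)
  qed
  have "f x = x * deriv f z" using z f0 by simp
  also have "\<dots> \<le> x * (D * f x)" using u[of z] z x x0 by (intro mult_left_mono) auto
  also have "\<dots> \<le> b * (D * f x)" using x D \<open>f x > 0\<close> by (intro mult_right_mono) auto
  also have "\<dots> < 1 * f x" using mult_strict_right_mono[OF b(3) \<open>f x > 0\<close>] by (simp add: mult_ac)
  finally show False by simp
qed

section \<open>The equation of the logarithmic derivative\<close>

lemma dp:
  assumes r: "r > 0"
  shows "((\<lambda>r. deriv f r / f r) has_real_derivative K r / (r * (f r)\<^sup>2)) (at r)"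
proof -
  have "f r \<noteq> 0" using f_pos[OF r] by simp
  then show ?thesis using r
    by (auto intro!: derivative_eq_intros df ddf simp: K_def field_simps power2_eq_square)
qed

text \<open>All terms with undifferentiated \<open>V\<close> cancel because \<open>f\<close> solves
  its own equation. Only \<open>V'\<close> survives, which carries self-interaction and coupling;
  the two contributions of \<open>n^2 / r\<close> add up to the source.\<close>

lemma dK:
  assumes r: "r > 0"
  shows "(K has_real_derivative deriv f r * f r / r
    + r * (f r)\<^sup>2 * (2 * A * f r * deriv f r + 2 * B * g r * deriv g r) - 2 * (of_int n)\<^sup>2 * (f r)\<^sup>2 / r\<^sup>2) (at r)"
  unfolding K_def[abs_def] using r
  by (auto intro!: derivative_eq_intros df ddf dV simp: field_simps power2_eq_square)

section \<open>Behaviour at infinity\<close>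

lemma laplacian_limit: "((\<lambda>r. ((of_int n)\<^sup>2 / r\<^sup>2 + V r) * f r) \<longlongrightarrow> 0) at_top"
proof -
  have "((\<lambda>r::real. (of_int n)\<^sup>2 / r\<^sup>2) \<longlongrightarrow> 0) at_top"
    by (intro real_tendsto_divide_at_top tendsto_const filterlim_pow_at_top filterlim_ident) auto
  then have "((\<lambda>r. ((of_int n)\<^sup>2 / r\<^sup>2 + V r) * f r) \<longlongrightarrow> (0 + 0) * t) at_top"
    by (intro tendsto_intros f_limit V_limit)
  then show ?thesis by simp
qed

text \<open>The mean value theorem gives a point \<open>z\<close> in each unit interval where
  \<open>f'\<close> is small, since \<open>f\<close> converges. From \<open>z\<close> to
  \<open>r + 1\<close> the quantity \<open>r * f'\<close> changes little, since its derivative is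
  \<open>r\<close> times a function tending to 0.\<close>

lemma deriv_limit: "(deriv f \<longlongrightarrow> 0) at_top"
proof (rule tendstoI)
  fix e :: real assume e: "e > 0"
  let ?h = "\<lambda>r. ((of_int n)\<^sup>2 / r\<^sup>2 + V r) * f r"
  have "\<forall>\<^sub>F r in at_top. \<bar>?h r\<bar> < e / 4 \<and> \<bar>f r - t\<bar> < e / 8 \<and> r > 1"
    using tendstoD[OF laplacian_limit, of "e/4"] tendstoD[OF f_limit, of "e/8"] e eventually_gt_at_top[of 1]
    by (auto simp: eventually_conj_iff dist_real_def)
  then obtain R where R: "\<And>r. r \<ge> R \<Longrightarrow> \<bar>?h r\<bar> < e / 4 \<and> \<bar>f r - t\<bar> < e / 8 \<and> r > 1"
    by (auto simp: eventually_at_top_linorder)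
  have "\<bar>deriv f (r + 1)\<bar> < e" if r: "r \<ge> R" for r
  proof -
    have r1: "r > 1" using R[OF r] by simp
    obtain z where z: "r < z" "z < r + 1" "f (r + 1) - f r = deriv f z"
      using MVT2[of r "r + 1" f "deriv f"] df r1 by force
    have "\<bar>f (r + 1) - f r\<bar> < e / 4" using R[OF r] R[of "r + 1"] r by linarith
    then have uz: "\<bar>deriv f z\<bar> < e / 4" using z by simp
    obtain y where y: "z < y" "y < r + 1"
      "(r + 1) * deriv f (r + 1) - z * deriv f z = (r + 1 - z) * (((of_int n)\<^sup>2 / y + y * V y) * f y)"
      using MVT2[of z "r + 1" "\<lambda>r. r * deriv f r" "\<lambda>y. ((of_int n)\<^sup>2 / y + y * V y) * f y"] z r1 dru by force
    have "((of_int n)\<^sup>2 / y + y * V y) * f y = y * ?h y" using y z r1 by (simp add: field_simps power2_eq_square)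
    then have "\<bar>((of_int n)\<^sup>2 / y + y * V y) * f y\<bar> \<le> (r + 1) * (e / 4)"
      using R[of y] y z r r1 by (simp only: abs_mult) (intro mult_mono, auto)
    then have "\<bar>(r + 1 - z) * (((of_int n)\<^sup>2 / y + y * V y) * f y)\<bar> \<le> 1 * ((r + 1) * (e / 4))"
      using z by (simp only: abs_mult[of "r + 1 - z"]) (intro mult_mono, auto)
    moreover have "\<bar>z * deriv f z\<bar> \<le> (r + 1) * (e / 4)"
      using z r1 uz by (simp only: abs_mult) (intro mult_mono, auto)
    moreover have "(r + 1) * deriv f (r + 1)
        = z * deriv f z + (r + 1 - z) * (((of_int n)\<^sup>2 / y + y * V y) * f y)"
      unfolding y(3)[symmetric] by simp
    ultimately have "\<bar>(r + 1) * deriv f (r + 1)\<bar> \<le> (r + 1) * (e / 4) + 1 * ((r + 1) * (e / 4))"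
      by (simp only: order_trans[OF abs_triangle_ineq add_mono])
    also have "\<dots> = (r + 1) * (e / 2)" by simp
    finally have "\<bar>deriv f (r + 1)\<bar> \<le> e / 2" using r1 by (simp add: abs_mult)
    then show ?thesis using e by simp
  qed
  then have "\<bar>deriv f r\<bar> < e" if "r \<ge> R + 1" for r using that[THEN diff_mono[of "R+1" r 1 1]]
    by (metis add_diff_cancel_right' diff_add_cancel le_diff_eq that)
  then show "\<forall>\<^sub>F r in at_top. dist (deriv f r) 0 < e"
    by (auto simp: eventually_at_top_linorder)
qed

text \<open>Every term of \<open>K r / r\<close> contains a factor tending to 0. This supplies the
  linear growth hypothesis of the maximum principle.\<close>

lemma K_over_r_limit: "((\<lambda>r. deriv f r / f r * (K r / r)) \<longlongrightarrow> 0) at_top"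
proof -
  have 1: "((\<lambda>r::real. 1 / r) \<longlongrightarrow> 0) at_top"
    by (rule real_tendsto_divide_at_top[OF tendsto_const filterlim_ident])
  have "((\<lambda>r. deriv f r / f r * (((of_int n)\<^sup>2 / r\<^sup>2 + V r) * f r * f r - deriv f r * f r * (1 / r) - (deriv f r)\<^sup>2)) \<longlongrightarrow>
     0 / t * (0 * t - 0 * t * 0 - 0\<^sup>2)) at_top"
    using t_pos by (intro tendsto_intros laplacian_limit deriv_limit f_limit 1) simp
  moreover have "\<forall>\<^sub>F r in at_top. deriv f r / f r * (((of_int n)\<^sup>2 / r\<^sup>2 + V r) * f r * f r - deriv f r * f r * (1 / r) - (deriv f r)\<^sup>2)
     = deriv f r / f r * (K r / r)"
    using eventually_gt_at_top[of 0]
  proof eventually_elim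
    case (elim r)
    then have "((of_int n)\<^sup>2 / r\<^sup>2 + V r) * f r * f r - deriv f r * f r * (1 / r) - (deriv f r)\<^sup>2 = K r / r"
      by (simp add: K_def field_simps power2_eq_square)
    then show ?case by simp
  qed
  ultimately have "((\<lambda>r. deriv f r / f r * (K r / r)) \<longlongrightarrow> 0 / t * (0 * t - 0 * t * 0 - 0\<^sup>2)) at_top"
    by (rule Lim_transform_eventually)
  then show ?thesis by simp
qed

lemma growth: "\<forall>\<^sub>F r in at_top. \<bar>deriv f r / f r * K r\<bar> \<le> r"
proof -
  have "\<forall>\<^sub>F r in at_top. \<bar>deriv f r / f r * (K r / r)\<bar> < 1"
    using tendstoD[OF K_over_r_limit, of 1] by (simp add: dist_real_def)
  then show ?thesis using eventually_gt_at_top[of 0]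
  proof eventually_elim
    case (elim r)
    then have "\<bar>deriv f r / f r * K r\<bar> / r < 1" by (simp add: abs_mult)
    then show ?case using elim(2) by (simp only: pos_divide_less_eq)
  qed
qed

lemma f_lower_eventually: "\<forall>\<^sub>F r in at_top. (t / 2)\<^sup>2 \<le> (f r)\<^sup>2"
proof -
  have "\<forall>\<^sub>F r in at_top. f r > t / 2" using order_tendstoD(1)[OF f_limit, of "t/2"] t_pos by simp
  then show ?thesis using t_pos by (auto elim!: eventually_mono intro!: power_mono)
qed

text \<open>For small \<open>r\<close> the angular term dominates: \<open>n^2 >= 1 >= b * D\<close>,
  so \<open>r * f'\<close> is nondecreasing, and boundedness of \<open>f\<close> excludes negative
  values. The negative part of \<open>p\<close> thus vanishes near 0, and no estimate of
  \<open>p\<close> at the origin is required.\<close>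

lemma deriv_nonneg_near_zero:
  assumes n: "n \<noteq> 0"
  shows "\<forall>\<^sub>F r in at_right 0. deriv f r \<ge> 0"
proof -
  obtain D where D: "D \<ge> 0" "\<forall>x\<in>{0..1}. \<bar>V x\<bar> \<le> D \<and> \<bar>f x\<bar> \<le> D" using bounded_on_interval by blast
  define b where "b = 1 / (1 + D)"
  have b: "0 < b" "b \<le> 1" "b * D \<le> 1" using D by (auto simp: b_def field_simps)
  have "deriv f r \<ge> - 0" if r: "0 < r" "r \<le> b" for r
  proof (rule deriv_lower_bound_near_zero[where R = b and f = f and u = "deriv f" and F = D])
    fix y assume y: "0 < y" "y \<le> b"
    show "(f has_real_derivative deriv f y) (at y)" using df y by auto
    show "((\<lambda>r. r * deriv f r) has_real_derivative ((of_int n)\<^sup>2 / y + y * V y) * f y) (at y)" using dru y by auto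
    have n1: "(of_int n)\<^sup>2 \<ge> (1::real)" using n by (metis of_int_power int_one_le_iff_zero_less of_int_1_le_iff zero_less_power2)
    have "\<bar>y * y * V y\<bar> \<le> 1 * b * D"
      unfolding abs_mult using D y b by (intro mult_mono) auto
    then have "y * y * V y \<ge> - 1" using b by (simp add: abs_le_iff)
    then have "(of_int n)\<^sup>2 + y * y * V y \<ge> 0" using n1 by simp
    then have "(of_int n)\<^sup>2 / y + y * V y \<ge> 0" using y by (simp add: field_simps)
    then show "((of_int n)\<^sup>2 / y + y * V y) * f y \<ge> - 0" using f_nonneg y by simp
    have "\<bar>f y\<bar> \<le> D" using D y b by auto
    then show "f y \<le> D" by simp
  qed fact+
  then show ?thesis using eventually_at_right_real[OF b(1)] by (auto elim!: eventually_mono)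
qed

text \<open>Applied on the interval up to \<open>x\<close> itself, the bound near zero gains a
  factor \<open>x\<close> from \<open>r * V r * f r\<close>, so \<open>f'\<close> tends to 0;
  division by \<open>f\<close> is harmless because \<open>f 0 > 0\<close>.\<close>

lemma flux_limit_zero:
  assumes n: "n = 0"
  shows "((\<lambda>r. deriv f r / f r * K r) \<longlongrightarrow> 0) (at_right 0)"
proof -
  obtain D where D: "D \<ge> 0" "\<forall>x\<in>{0..1}. \<bar>V x\<bar> \<le> D \<and> \<bar>f x\<bar> \<le> D" using bounded_on_interval by blast
  have e: "\<bar>y * V y * f y\<bar> \<le> x * (D * D)" if "0 < y" "y \<le> x" "x \<le> 1" for x y
    using D that unfolding abs_mult mult.assoc by (intro mult_mono) auto
  have u: "\<bar>deriv f x\<bar> \<le> x * (D * D)" if x: "0 < x" "x \<le> 1" for x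
  proof -
    have "deriv f x \<ge> - (x * (D * D))"
    proof (rule deriv_lower_bound_near_zero[where R = x and f = f and u = "deriv f" and F = D])
      fix y assume y: "0 < y" "y \<le> x"
      show "((\<lambda>r. r * deriv f r) has_real_derivative y * V y * f y) (at y)" using dru y n by force
      show "- (x * (D * D)) \<le> y * V y * f y" using e[OF y x(2)] by linarith
      have "\<bar>f y\<bar> \<le> D" using D y x by auto
      then show "f y \<le> D" by simp
    qed (use df x in auto)
    moreover have "- deriv f x \<ge> - (x * (D * D))"
    proof (rule deriv_lower_bound_near_zero[where R = x and f = "\<lambda>r. - f r" and u = "\<lambda>r. - deriv f r" and F = 0 and e = "\<lambda>r. - (r * V r * f r)"])
      fix y assume y: "0 < y" "y \<le> x"
      show "((\<lambda>r. - f r) has_real_derivative - deriv f y) (at y)" using df y by (auto intro: derivative_intros)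
      show "((\<lambda>r. r * - deriv f r) has_real_derivative - (y * V y * f y)) (at y)"
        using dru[OF y(1)] n by (auto dest: DERIV_minus)
      show "- (x * (D * D)) \<le> - (y * V y * f y)" using e[OF y x(2)] by linarith
      show "- f y \<le> 0" using y f_nonneg by simp
    qed (use x in auto)
    ultimately show ?thesis by linarith
  qed
  have u0: "(deriv f \<longlongrightarrow> 0) (at_right 0)"
  proof (rule Lim_null_comparison)
    show "\<forall>\<^sub>F x in at_right 0. norm (deriv f x) \<le> x * (D * D)"
      using eventually_at_right_real[of 0 1] u by (auto elim!: eventually_mono)
    have "((\<lambda>x. x * (D * D)) \<longlongrightarrow> 0 * (D * D)) (at_right 0)" by (intro tendsto_intros)
    then show "((\<lambda>x. x * (D * D)) \<longlongrightarrow> 0) (at_right 0)" by simp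
  qed
  have lim: "(h \<longlongrightarrow> h 0) (at_right 0)" if "continuous_on {0..} h" for h :: "real \<Rightarrow> real"
    using that by (auto simp: continuous_on_def intro: tendsto_within_subset)
  have "((\<lambda>r. deriv f r / f r * ((0 + r * V r) * (f r)\<^sup>2 - deriv f r * f r - r * (deriv f r)\<^sup>2)) \<longlongrightarrow>
     0 / f 0 * ((0 + 0 * V 0) * (f 0)\<^sup>2 - 0 * f 0 - 0 * 0\<^sup>2)) (at_right 0)"
    using f_zero_pos[OF n] by (intro tendsto_intros u0 lim f_continuous V_continuous) simp
  then show ?thesis unfolding K_def by (simp add: n)
qed

lemma negative_flux_limit_zero: "((\<lambda>r. min (deriv f r / f r) 0 * K r) \<longlongrightarrow> 0) (at_right 0)"
proof (cases "n = 0")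
  case True
  show ?thesis
  proof (rule Lim_null_comparison)
    show "\<forall>\<^sub>F r in at_right 0. norm (min (deriv f r / f r) 0 * K r) \<le> \<bar>deriv f r / f r * K r\<bar>"
      by (intro always_eventually allI) (auto simp: min_def)
    show "((\<lambda>r. \<bar>deriv f r / f r * K r\<bar>) \<longlongrightarrow> 0) (at_right 0)"
      using flux_limit_zero[OF True] by (rule tendsto_rabs_zero)
  qed
next
  case False
  have "\<forall>\<^sub>F r in at_right 0. 0 = min (deriv f r / f r) 0 * K r"
    using deriv_nonneg_near_zero[OF False] eventually_at_right_less[of 0]
  proof eventually_elim
    case (elim r)
    then show ?case using divide_nonneg_pos[OF _ f_pos[of r]] by (simp add: min_absorb2)
  qed
  then show ?thesis by (rule Lim_transform_eventually[rotated]) simp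
qed

end

section \<open>Sign of the derivatives\<close>

locale radial_pair =
  P: radial_component A t B s n f g + Q: radial_component A' s B t m g f
  for A A' t B s :: real and n m :: int and f g :: "real \<Rightarrow> real"
begin

lemma deriv_nonneg_of_negative_coupling:
  assumes "A > 0" "A' > 0" "B\<^sup>2 < A * A'" "B \<le> 0" and r: "r > 0"
  shows "deriv f r \<ge> 0 \<and> deriv g r \<ge> 0"
proof -
  have "deriv f r / f r \<ge> 0 \<and> deriv g r / g r \<ge> 0"
  proof (rule cooperative_system_nonneg[where f = f and g = g and p = "\<lambda>r. deriv f r / f r"
        and q = "\<lambda>r. deriv g r / g r" and K = P.K and J = Q.K
        and S = "\<lambda>r. 2 * (of_int n)\<^sup>2 * (f r)\<^sup>2 / r\<^sup>2" and T = "\<lambda>r. 2 * (of_int m)\<^sup>2 * (g r)\<^sup>2 / r\<^sup>2"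
        and b = B and A = A and A' = A' and C = 1 and \<kappa> = "min ((t / 2)\<^sup>2) ((s / 2)\<^sup>2)"])
    fix r :: real assume r: "r > 0"
    have fg: "f r > 0" "g r > 0" using P.f_pos Q.f_pos r by auto
    have eq: "deriv f r / f r * (f r)\<^sup>2 = deriv f r * f r" "deriv g r / g r * (g r)\<^sup>2 = deriv g r * g r"
      "(f r)\<^sup>2 * (deriv f r / f r) = f r * deriv f r" "(g r)\<^sup>2 * (deriv g r / g r) = g r * deriv g r"
      using fg by (auto simp: power2_eq_square)
    show "f r > 0" "g r > 0" using fg by auto
    show "((\<lambda>r. deriv f r / f r) has_real_derivative P.K r / (r * (f r)\<^sup>2)) (at r)"
      "((\<lambda>r. deriv g r / g r) has_real_derivative Q.K r / (r * (g r)\<^sup>2)) (at r)"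
      using P.dp Q.dp r by auto
    show "(P.K has_real_derivative deriv f r / f r * (f r)\<^sup>2 / r + 2 * r * (f r)\<^sup>2 *
          (A * (f r)\<^sup>2 * (deriv f r / f r) + B * (g r)\<^sup>2 * (deriv g r / g r)) - 2 * (of_int n)\<^sup>2 * (f r)\<^sup>2 / r\<^sup>2) (at r)"
      using P.dK[OF r] by (simp only: mult.assoc eq) (simp add: algebra_simps)
    show "(Q.K has_real_derivative deriv g r / g r * (g r)\<^sup>2 / r + 2 * r * (g r)\<^sup>2 *
          (A' * (g r)\<^sup>2 * (deriv g r / g r) + B * (f r)\<^sup>2 * (deriv f r / f r)) - 2 * (of_int m)\<^sup>2 * (g r)\<^sup>2 / r\<^sup>2) (at r)"
      using Q.dK[OF r] by (simp only: mult.assoc eq) (simp add: algebra_simps)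
  next
    show "\<forall>\<^sub>F r in at_top. min ((t / 2)\<^sup>2) ((s / 2)\<^sup>2) \<le> (f r)\<^sup>2"
      using P.f_lower_eventually by eventually_elim simp
    show "\<forall>\<^sub>F r in at_top. min ((t / 2)\<^sup>2) ((s / 2)\<^sup>2) \<le> (g r)\<^sup>2"
      using Q.f_lower_eventually by eventually_elim simp
  qed (use assms P.t_pos Q.t_pos P.negative_flux_limit_zero Q.negative_flux_limit_zero P.growth Q.growth in auto)
  then show ?thesis using P.f_pos[OF r] Q.f_pos[OF r] by (simp add: zero_le_divide_iff)
qed

text \<open>Replacing \<open>g'\<close> by \<open>- g'\<close> changes the sign of the coupling; this is compatible with the
  source term \<open>2 m\<^sup>2 g\<^sup>2 / r\<^sup>2\<close> of the second equation only if it vanishes.\<close>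

lemma deriv_signs_of_positive_coupling:
  assumes "A > 0" "A' > 0" "B\<^sup>2 < A * A'" "B \<ge> 0" and m: "m = 0" and r: "r > 0"
  shows "deriv f r \<ge> 0 \<and> deriv g r \<le> 0"
proof -
  have "deriv f r / f r \<ge> 0 \<and> - (deriv g r / g r) \<ge> 0"
  proof (rule cooperative_system_nonneg[where f = f and g = g and p = "\<lambda>r. deriv f r / f r"
        and q = "\<lambda>r. - (deriv g r / g r)" and K = P.K and J = "\<lambda>r. - Q.K r"
        and S = "\<lambda>r. 2 * (of_int n)\<^sup>2 * (f r)\<^sup>2 / r\<^sup>2" and T = "\<lambda>r. 0"
        and b = "- B" and A = A and A' = A' and C = 1 and \<kappa> = "min ((t / 2)\<^sup>2) ((s / 2)\<^sup>2)"])
    fix r :: real assume r: "r > 0"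
    have fg: "f r > 0" "g r > 0" using P.f_pos Q.f_pos r by auto
    have eq: "deriv f r / f r * (f r)\<^sup>2 = deriv f r * f r" "deriv g r / g r * (g r)\<^sup>2 = deriv g r * g r"
      "(f r)\<^sup>2 * (deriv f r / f r) = f r * deriv f r" "(g r)\<^sup>2 * (deriv g r / g r) = g r * deriv g r"
      using fg by (auto simp: power2_eq_square)
    show "f r > 0" "g r > 0" using fg by auto
    show "((\<lambda>r. deriv f r / f r) has_real_derivative P.K r / (r * (f r)\<^sup>2)) (at r)"
      using P.dp r by auto
    show "((\<lambda>r. - (deriv g r / g r)) has_real_derivative - Q.K r / (r * (g r)\<^sup>2)) (at r)"
      using DERIV_minus[OF Q.dp[OF r]] by simp
    show "(P.K has_real_derivative deriv f r / f r * (f r)\<^sup>2 / r + 2 * r * (f r)\<^sup>2 *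
          (A * (f r)\<^sup>2 * (deriv f r / f r) + - B * (g r)\<^sup>2 * - (deriv g r / g r)) - 2 * (of_int n)\<^sup>2 * (f r)\<^sup>2 / r\<^sup>2) (at r)"
      using P.dK[OF r] unfolding minus_mult_minus minus_mult_left[symmetric] minus_mult_right[symmetric] minus_minus
      by (simp only: mult.assoc eq) (simp add: algebra_simps)
    show "((\<lambda>r. - Q.K r) has_real_derivative - (deriv g r / g r) * (g r)\<^sup>2 / r + 2 * r * (g r)\<^sup>2 *
          (A' * (g r)\<^sup>2 * - (deriv g r / g r) + - B * (f r)\<^sup>2 * (deriv f r / f r)) - 0) (at r)"
      using DERIV_minus[OF Q.dK[OF r]] m unfolding minus_mult_left[symmetric] minus_mult_right[symmetric]
      by (simp only: mult.assoc eq) (simp add: algebra_simps)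
  next
    \<comment> \<open>The truncation now sees the positive part of \<open>g' / g\<close>, so the
      one-sided statement does not help; degree zero provides the limit of the full flux.\<close>
    show "((\<lambda>r. min (- (deriv g r / g r)) 0 * - Q.K r) \<longlongrightarrow> 0) (at_right 0)"
    proof (rule Lim_null_comparison)
      show "\<forall>\<^sub>F r in at_right 0. norm (min (- (deriv g r / g r)) 0 * - Q.K r) \<le> \<bar>deriv g r / g r * Q.K r\<bar>"
        unfolding real_norm_def abs_mult by (intro always_eventually allI mult_mono) (simp_all add: min_def flip: abs_divide)
      show "((\<lambda>r. \<bar>deriv g r / g r * Q.K r\<bar>) \<longlongrightarrow> 0) (at_right 0)"
        using Q.flux_limit_zero[OF m] by (rule tendsto_rabs_zero)
    qed
    show "\<forall>\<^sub>F r in at_top. min ((t / 2)\<^sup>2) ((s / 2)\<^sup>2) \<le> (f r)\<^sup>2"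
      using P.f_lower_eventually by eventually_elim simp
    show "\<forall>\<^sub>F r in at_top. min ((t / 2)\<^sup>2) ((s / 2)\<^sup>2) \<le> (g r)\<^sup>2"
      using Q.f_lower_eventually by eventually_elim simp
    show "\<forall>\<^sub>F r in at_top. \<bar>- (deriv g r / g r) * - Q.K r\<bar> \<le> 1 * r"
      using Q.growth by eventually_elim simp
  qed (use assms P.t_pos Q.t_pos P.negative_flux_limit_zero P.growth in auto)
  then show ?thesis using P.f_pos[OF r] Q.f_pos[OF r] by (simp add: zero_le_divide_iff divide_le_0_iff)
qed

end

text \<open>If the coupling is weak enough to be absorbed into the source term \<open>2 n\<^sup>2 f\<^sup>2 / r\<^sup>2\<close>, the two
  equations decouple.\<close>

lemma (in radial_component) deriv_nonneg_of_weak_coupling: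
  assumes A: "A > 0" and weak: "\<And>r. r > 0 \<Longrightarrow> B * (r ^ 3 * (g r * deriv g r)) \<le> (of_int n)\<^sup>2"
    and r: "r > 0"
  shows "deriv f r \<ge> 0"
proof -
  \<comment> \<open>The source minus the coupling term \<open>2 * B * r * f^2 * g * g'\<close>;
    \<open>weak\<close> says precisely that this difference is nonnegative.\<close>
  define S where "S = (\<lambda>r. 2 * (f r)\<^sup>2 / r\<^sup>2 * ((of_int n)\<^sup>2 - B * (r ^ 3 * (g r * deriv g r))))"
  \<comment> \<open>The scalar case is obtained from the system by taking two copies of the same
    equation with coupling 0.\<close>
  have "deriv f r / f r \<ge> 0 \<and> deriv f r / f r \<ge> 0"
  proof (rule cooperative_system_nonneg[where f = f and g = f and p = "\<lambda>r. deriv f r / f r"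
        and q = "\<lambda>r. deriv f r / f r" and K = K and J = K and S = S and T = S
        and b = 0 and A = A and A' = A and C = 1 and \<kappa> = "(t / 2)\<^sup>2"])
    fix r :: real assume r: "r > 0"
    have f: "f r > 0" using f_pos r by auto
    show "f r > 0" "f r > 0" using f by auto
    show "((\<lambda>r. deriv f r / f r) has_real_derivative K r / (r * (f r)\<^sup>2)) (at r)"
      "((\<lambda>r. deriv f r / f r) has_real_derivative K r / (r * (f r)\<^sup>2)) (at r)"
      using dp r by auto
    have "(K has_real_derivative deriv f r / f r * (f r)\<^sup>2 / r + 2 * r * (f r)\<^sup>2 *
          (A * (f r)\<^sup>2 * (deriv f r / f r) + 0 * (f r)\<^sup>2 * (deriv f r / f r)) - S r) (at r)"
      by (rule DERIV_cong[OF dK[OF r]]) (use f r in \<open>simp add: S_def field_simps power2_eq_square power3_eq_cube\<close>)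
    then show "(K has_real_derivative deriv f r / f r * (f r)\<^sup>2 / r + 2 * r * (f r)\<^sup>2 *
          (A * (f r)\<^sup>2 * (deriv f r / f r) + 0 * (f r)\<^sup>2 * (deriv f r / f r)) - S r) (at r)"
      "(K has_real_derivative deriv f r / f r * (f r)\<^sup>2 / r + 2 * r * (f r)\<^sup>2 *
          (A * (f r)\<^sup>2 * (deriv f r / f r) + 0 * (f r)\<^sup>2 * (deriv f r / f r)) - S r) (at r)" by this+
    show "S r \<ge> 0" "S r \<ge> 0" using weak[OF r] by (auto simp: S_def intro!: divide_nonneg_nonneg mult_nonneg_nonneg)
  qed (use A r t_pos f_lower_eventually negative_flux_limit_zero growth in \<open>auto\<close>)
  then show ?thesis using f_pos[OF r] by (simp add: zero_le_divide_iff)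
qed

section \<open>Decay of the derivatives, uniformly in the coupling\<close>

lemma second_derivative_at_max:
  fixes h u :: "real \<Rightarrow> real"
  assumes x: "a < x" "x < b" and max: "\<And>y. a < y \<Longrightarrow> y < b \<Longrightarrow> h y \<le> h x"
    and dh: "\<And>y. a < y \<Longrightarrow> y < b \<Longrightarrow> (h has_real_derivative u y) (at y)"
    and dh1: "(u has_real_derivative d) (at x)"
  shows "u x = 0 \<and> d \<le> 0"
proof
  define w where "w = min (x - a) (b - x)"
  have w: "w > 0" using x by (simp add: w_def)
  have near: "a < y \<and> y < b" if "\<bar>x - y\<bar> < w" for y using that by (auto simp: w_def)
  show ux: "u x = 0"
    using DERIV_local_max[OF dh[OF x] w] max near by blast
  show "d \<le> 0"
  proof (rule ccontr)
    assume "\<not> d \<le> 0"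
    then obtain e where e: "e > 0" "\<And>k. 0 < k \<Longrightarrow> k < e \<Longrightarrow> u x < u (x + k)"
      using DERIV_pos_inc_right[OF dh1] by auto
    define k where "k = min (e / 2) (w / 2)"
    have k: "0 < k" "k < e" "k < w" using e w by (auto simp: k_def min_def)
    have "h x < h (x + k)"
    proof (rule DERIV_pos_imp_increasing_open[of x "x + k" h])
      show "x < x + k" using k by simp
      fix y assume y: "x < y" "y < x + k"
      then have "u y > 0" using e(2)[of "y - x"] k ux by auto
      moreover have "(h has_real_derivative u y) (at y)" using near[of y] y k by (intro dh) auto
      ultimately show "\<exists>l. DERIV h y :> l \<and> l > 0" by blast
    next
      have "isCont h y" if "y \<in> {x..x+k}" for y
        using DERIV_isCont dh near[of y] that k by fastforce
      then show "continuous_on {x..x + k} h" by (intro continuous_at_imp_continuous_on ballI)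
    qed
    then show False using max[of "x + k"] near[of "x + k"] k by force
  qed
qed

lemma interior_max:
  fixes h :: "real \<Rightarrow> real"
  assumes cont: "continuous_on {a..b} h" and "h a \<le> c" "h b \<le> c" and r: "r \<in> {a..b}" "h r > c"
  obtains x where "a < x" "x < b" "h x > c" "\<And>y. a \<le> y \<Longrightarrow> y \<le> b \<Longrightarrow> h y \<le> h x"
proof -
  obtain x where x: "x \<in> {a..b}" "\<And>y. y \<in> {a..b} \<Longrightarrow> h y \<le> h x"
    using continuous_attains_sup[of "{a..b}" h] cont r by force
  have "h x > c" using x(2)[OF r(1)] r(2) by simp
  moreover from this have "x \<noteq> a" "x \<noteq> b" using assms by auto
  ultimately show ?thesis using x by (intro that[of x]) auto
qed

section \<open>Bounds on one component by comparison functions\<close>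

context radial_component
begin

text \<open>At an interior maximum the equation forces \<open>V <= 0\<close>, and dropping
  \<open>B * g^2 >= 0\<close> leaves a bound on \<open>f\<close> that does not involve
  \<open>g\<close>.\<close>

lemma f_upper_bound:
  assumes A: "A > 0" "B \<ge> 0" and n: "n \<noteq> 0" and F: "F \<ge> 0" "t\<^sup>2 + B * s\<^sup>2 / A \<le> F\<^sup>2" and r: "r \<ge> 0"
  shows "f r \<le> F"
proof (rule ccontr)
  assume neg: "\<not> f r \<le> F"
  have "t\<^sup>2 \<le> F\<^sup>2" using F A by (smt (verit) divide_nonneg_pos mult_nonneg_nonneg zero_le_power2)
  then have tF: "t \<le> F" using F(1) by (rule power2_le_imp_le)
  \<comment> \<open>A level strictly above \<open>F >= t\<close>, so that \<open>f\<close> is below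
    it far out and the maximum is interior.\<close>
  define c where "c = (F + f r) / 2"
  have c: "F < c" "c < f r" using neg by (auto simp: c_def)
  have "\<forall>\<^sub>F x in at_top. f x < c \<and> x \<ge> r"
    using order_tendstoD(2)[OF f_limit, of c] tF c eventually_ge_at_top[of r] by (auto simp: eventually_conj_iff)
  then obtain b where b: "f b < c" "b \<ge> r" by (auto simp: eventually_at_top_linorder)
  obtain x where x: "0 < x" "x < b" "f x > c" "\<And>y. 0 \<le> y \<Longrightarrow> y \<le> b \<Longrightarrow> f y \<le> f x"
  proof (rule interior_max[of 0 b f c r])
    show "continuous_on {0..b} f" by (rule continuous_on_subset[OF f_continuous]) auto
  qed (use b r c f_zero[OF n] F in auto)
  have "deriv f x = 0 \<and> ((of_int n)\<^sup>2 / x\<^sup>2 + V x) * f x - deriv f x / x \<le> 0"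
    by (rule second_derivative_at_max[where h = f and u = "deriv f" and x = x and a = 0 and b = b]) (use x df ddf in auto)
  then have "((of_int n)\<^sup>2 / x\<^sup>2 + V x) * f x \<le> 0" by (elim conjE) simp
  then have "(of_int n)\<^sup>2 / x\<^sup>2 + V x \<le> 0" using f_pos[OF x(1)] by (simp add: mult_le_0_iff)
  then have "V x \<le> 0" by (smt (verit) divide_nonneg_nonneg zero_le_power2)
  moreover have "B * (g x)\<^sup>2 \<ge> 0" using A by simp
  ultimately have "A * (f x)\<^sup>2 \<le> A * t\<^sup>2 + B * s\<^sup>2" by (simp add: V_def algebra_simps)
  then have "(f x)\<^sup>2 \<le> t\<^sup>2 + B * s\<^sup>2 / A" using A by (simp add: field_simps)
  then have "(f x)\<^sup>2 \<le> F\<^sup>2" using F by simp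
  then have "f x \<le> F" using F(1) by (rule power2_le_imp_le)
  then show False using x c by simp
qed

lemma n_square_ge_1: "n \<noteq> 0 \<Longrightarrow> (of_int n)\<^sup>2 \<ge> (1::real)"
  by (metis of_int_power int_one_le_iff_zero_less of_int_1_le_iff zero_less_power2)

text \<open>Comparison with \<open>C r - k r\<^sup>2 / 3\<close>, where \<open>w = r\<^sup>2\<close> satisfies \<open>w'' + w' / r - w / r\<^sup>2 = 3\<close>.\<close>

lemma f_le_linear:
  assumes n: "n \<noteq> 0" and F: "\<forall>r\<ge>0. f r \<le> F" and D: "D \<ge> 0" "\<forall>r\<ge>0. \<bar>V r\<bar> \<le> D"
    and r: "r \<ge> 0"
  shows "f r \<le> (F + D * F / 3) * r"
proof -
  define k where "k = D * F"
  \<comment> \<open>With this choice the comparison function equals \<open>F\<close> at 1, and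
    \<open>k\<close> bounds \<open>\<bar>V * f\<bar>\<close>.\<close>
  define C where "C = F + k / 3"
  have F0: "F \<ge> 0" using F[rule_format, of 0] f_nonneg[of 0] by simp
  have k: "k \<ge> 0" using D F0 by (simp add: k_def)
  have small: "f r \<le> C * r - k / 3 * r\<^sup>2" if r: "0 \<le> r" "r \<le> 1" for r
  proof (rule ccontr)
    assume neg: "\<not> f r \<le> C * r - k / 3 * r\<^sup>2"
    let ?h = "\<lambda>r. f r - (C * r - k / 3 * r\<^sup>2)"
    obtain x where x: "0 < x" "x < 1" "?h x > 0" "\<And>y. 0 \<le> y \<Longrightarrow> y \<le> 1 \<Longrightarrow> ?h y \<le> ?h x"
    proof (rule interior_max[of 0 1 ?h 0 r])
      show "continuous_on {0..1} ?h"
        by (intro continuous_intros continuous_on_subset[OF f_continuous]) auto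
    qed (use r neg f_zero[OF n] F in \<open>auto simp: C_def\<close>)
    have *: "deriv f x - (C - 2 * k / 3 * x) = 0 \<and> ((of_int n)\<^sup>2 / x\<^sup>2 + V x) * f x - deriv f x / x + 2 * k / 3 \<le> 0"
      by (rule second_derivative_at_max[where h = ?h and u = "\<lambda>x. deriv f x - (C - 2 * k / 3 * x)" and x = x and a = 0 and b = 1])
        (use x in \<open>auto intro!: derivative_eq_intros df ddf\<close>)
    then have "deriv f x / x = (C - 2 * k / 3 * x) / x" by simp
    also have "\<dots> = C / x - 2 * k / 3" using x by (simp add: field_simps)
    finally have "(of_int n)\<^sup>2 / x\<^sup>2 * f x + V x * f x - C / x + 4 * k / 3 \<le> 0" using * by (simp add: algebra_simps)
    moreover have "V x * f x \<ge> - k"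
    proof -
      have "\<bar>V x * f x\<bar> \<le> D * F" unfolding abs_mult
        using D F f_nonneg[of x] x by (intro mult_mono) auto
      then show ?thesis by (simp add: k_def abs_le_iff)
    qed
    moreover have "(of_int n)\<^sup>2 / x\<^sup>2 * f x > C / x - k / 3"
    proof -
      have "C / x - k / 3 = (C * x - k / 3 * x\<^sup>2) / x\<^sup>2" using x by (simp add: field_simps power2_eq_square)
      also have "\<dots> < f x / x\<^sup>2" using x by (intro divide_strict_right_mono) auto
      also have "\<dots> \<le> (of_int n)\<^sup>2 * (f x / x\<^sup>2)"
        using mult_right_mono[OF n_square_ge_1[OF n], of "f x / x\<^sup>2"] f_nonneg[of x] x by simp
      finally show ?thesis by simp
    qed
    \<comment> \<open>The multiples of \<open>k\<close> cancel exactly: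
      \<open>- k - k / 3 + 4 * k / 3 = 0\<close>, and the bound on the angular term is
      strict.\<close>
    ultimately show False using k by linarith
  qed
  show ?thesis
  proof (cases "r \<le> 1")
    case True
    have "k / 3 * r\<^sup>2 \<ge> 0" using k by simp
    then show ?thesis using small[OF r True] by (simp add: C_def k_def)
  next
    case False
    have "f r \<le> C * 1" using F[rule_format, OF r] k by (simp add: C_def)
    also have "\<dots> \<le> C * r" using False k F0 by (intro mult_left_mono) (auto simp: C_def)
    finally show ?thesis by (simp add: C_def k_def)
  qed
qed

text \<open>The derivative of \<open>r * f'\<close> is \<open>(n^2 + r^2 * V) * (f / r)\<close>, and
  \<open>f / r\<close> is bounded up to the origin by the linear bound. Excluding logarithmic
  blow-up of \<open>f\<close> and of \<open>- f\<close> then bounds \<open>f'\<close> on both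
  sides.\<close>

lemma deriv_bound:
  assumes n: "n \<noteq> 0" and F: "\<forall>r\<ge>0. f r \<le> F" and D: "D \<ge> 0" "\<forall>r\<ge>0. \<bar>V r\<bar> \<le> D"
    and N: "(of_int n)\<^sup>2 \<le> N" and r: "0 < r" "r \<le> R"
  shows "\<bar>deriv f r\<bar> \<le> (N + R\<^sup>2 * D) * (F + D * F / 3)"
proof -
  define M where "M = (N + R\<^sup>2 * D) * (F + D * F / 3)"
  have e: "\<bar>((of_int n)\<^sup>2 / y + y * V y) * f y\<bar> \<le> M" if y: "0 < y" "y \<le> R" for y
  proof -
    have "((of_int n)\<^sup>2 / y + y * V y) * f y = ((of_int n)\<^sup>2 + y\<^sup>2 * V y) * (f y / y)"
      using y by (simp add: field_simps power2_eq_square)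
    moreover have "\<bar>(of_int n)\<^sup>2 + y\<^sup>2 * V y\<bar> \<le> N + R\<^sup>2 * D"
    proof -
      have "\<bar>y\<^sup>2 * V y\<bar> \<le> R\<^sup>2 * D" unfolding abs_mult using y D by (intro mult_mono) auto
      then show ?thesis using N by (smt (verit) zero_le_power2)
    qed
    moreover have "\<bar>f y / y\<bar> \<le> F + D * F / 3"
      using f_le_linear[OF n F D, of y] f_nonneg[of y] y by (simp add: pos_divide_le_eq)
    ultimately show ?thesis unfolding M_def by (simp only: abs_mult) (intro mult_mono, auto)
  qed
  have "deriv f r \<ge> - M"
    by (rule deriv_lower_bound_near_zero[where f = f and u = "deriv f" and R = R and F = F,
        OF df dru]) (use e F r in \<open>auto simp: abs_le_iff minus_le_iff\<close>)
  moreover have "- deriv f r \<ge> - M"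
  proof (rule deriv_lower_bound_near_zero[where f = "\<lambda>r. - f r" and u = "\<lambda>r. - deriv f r" and R = R and F = 0
        and e = "\<lambda>y. - (((of_int n)\<^sup>2 / y + y * V y) * f y)"])
    fix y assume y: "0 < y" "y \<le> R"
    show "((\<lambda>r. - f r) has_real_derivative - deriv f y) (at y)" using df y by (auto intro: derivative_intros)
    show "((\<lambda>r. r * - deriv f r) has_real_derivative - (((of_int n)\<^sup>2 / y + y * V y) * f y)) (at y)"
      using DERIV_minus[OF dru[OF y(1)]] by simp
    show "- M \<le> - (((of_int n)\<^sup>2 / y + y * V y) * f y)" using e[OF y] by linarith
    show "- f y \<le> 0" using f_nonneg y by simp
  qed (use r in auto)
  ultimately show ?thesis unfolding M_def by linarith
qed

text \<open>The comparison function is a subsolution: with \<open>y = \<rho>\<^sup>2 / r\<^sup>2\<close> the required inequality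
  reduces to \<open>20 y\<^sup>2 - 16 y + 4 \<ge> 0\<close>.\<close>

lemma f_lower_bound:
  assumes A: "A > 0" and T: "0 < T" "T < t" "\<And>r. r \<ge> 0 \<Longrightarrow> V r \<le> A * ((f r)\<^sup>2 - T\<^sup>2)"
    and \<rho>: "\<rho> > 0" "A * T\<^sup>2 * \<rho>\<^sup>2 = (of_int n)\<^sup>2 + 4" and r: "r \<ge> \<rho>"
  shows "T * (1 - \<rho>\<^sup>2 / r\<^sup>2)\<^sup>2 \<le> f r"
proof (rule ccontr)
  assume neg: "\<not> T * (1 - \<rho>\<^sup>2 / r\<^sup>2)\<^sup>2 \<le> f r"
  define \<phi> where "\<phi> = (\<lambda>r. T * (1 - \<rho>\<^sup>2 / r\<^sup>2)\<^sup>2)"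
  define \<phi>1 where "\<phi>1 = (\<lambda>r. 4 * T * \<rho>\<^sup>2 / r ^ 3 - 4 * T * \<rho> ^ 4 / r ^ 5)"
  define \<phi>2 where "\<phi>2 = (\<lambda>r. - 12 * T * \<rho>\<^sup>2 / r ^ 4 + 20 * T * \<rho> ^ 4 / r ^ 6)"
  have d\<phi>: "(\<phi> has_real_derivative \<phi>1 x) (at x)" "(\<phi>1 has_real_derivative \<phi>2 x) (at x)" if "x > 0" for x
    using that unfolding \<phi>_def \<phi>1_def \<phi>2_def
    by (auto intro!: derivative_eq_intros simp: field_simps eval_nat_numeral)
  have r0: "r > 0" using r \<rho> by simp
  \<comment> \<open>The quotient is maximised instead of the difference: with \<open>l\<close> its
    maximum, \<open>l * f\<close> touches \<open>\<phi>\<close> from above and solves the same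
    linear equation as \<open>f\<close>, so both sides carry the potential times the same value
    \<open>\<phi> x\<close>.\<close>
  let ?h = "\<lambda>x. \<phi> x / f x"
  have "\<forall>\<^sub>F x in at_top. f x > T \<and> x \<ge> r"
    using order_tendstoD(1)[OF f_limit T(2)] eventually_ge_at_top[of r] by (auto simp: eventually_conj_iff)
  then obtain b where b: "f b > T" "b \<ge> r" by (auto simp: eventually_at_top_linorder)
  obtain x where x: "\<rho> < x" "x < b" "?h x > 1" "\<And>y. \<rho> \<le> y \<Longrightarrow> y \<le> b \<Longrightarrow> ?h y \<le> ?h x"
  proof (rule interior_max[of \<rho> b ?h 1 r])
    have "isCont ?h y" if "y \<ge> \<rho>" for y
      using DERIV_isCont[OF d\<phi>(1)] DERIV_isCont[OF df] f_pos[of y] that \<rho> by (intro continuous_intros) auto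
    then show "continuous_on {\<rho>..b} ?h" by (intro continuous_at_imp_continuous_on) auto
    show "?h \<rho> \<le> 1" using \<rho> by (simp add: \<phi>_def)
    have "\<rho>\<^sup>2 / b\<^sup>2 \<le> 1" using b r \<rho> by (simp add: power_mono)
    then have "(1 - \<rho>\<^sup>2 / b\<^sup>2)\<^sup>2 \<le> 1" by (intro power_le_one) auto
    then have "\<phi> b \<le> T" unfolding \<phi>_def using T by simp
    then show "?h b \<le> 1" using b T by (simp add: divide_le_eq)
    show "1 < ?h r" using neg f_pos[OF r0] by (simp add: \<phi>_def less_divide_eq)
  qed (use b r in auto)
  have x0: "x > 0" using x \<rho> by simp
  have fx: "f x > 0" using f_pos x0 by simp
  define l where "l = ?h x"
  have l: "l > 1" "\<phi> x = l * f x" using x fx by (auto simp: l_def)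
  have test: "\<phi>1 x - l * deriv f x = 0 \<and> \<phi>2 x - l * (((of_int n)\<^sup>2 / x\<^sup>2 + V x) * f x - deriv f x / x) \<le> 0"
  proof (rule second_derivative_at_max[where h = "\<lambda>y. \<phi> y - l * f y" and u = "\<lambda>y. \<phi>1 y - l * deriv f y" and x = x and a = \<rho> and b = b])
    fix y assume y: "\<rho> < y" "y < b"
    have "f y > 0" using f_pos y \<rho> by simp
    moreover have "?h y \<le> l" using x(4)[of y] y by (simp add: l_def)
    ultimately show "\<phi> y - l * f y \<le> \<phi> x - l * f x" using l by (simp add: divide_le_eq)
    show "((\<lambda>y. \<phi> y - l * f y) has_real_derivative \<phi>1 y - l * deriv f y) (at y)"
      using y \<rho> by (auto intro!: derivative_eq_intros d\<phi> df)
  next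
    show "((\<lambda>y. \<phi>1 y - l * deriv f y) has_real_derivative
       \<phi>2 x - l * (((of_int n)\<^sup>2 / x\<^sup>2 + V x) * f x - deriv f x / x)) (at x)"
      using x0 by (auto intro!: derivative_eq_intros d\<phi> ddf)
  qed (use x in auto)
  then have "deriv f x = \<phi>1 x / l" using l by (simp add: field_simps)
  then have "l * (((of_int n)\<^sup>2 / x\<^sup>2 + V x) * f x - deriv f x / x) = ((of_int n)\<^sup>2 / x\<^sup>2 + V x) * \<phi> x - \<phi>1 x / x"
    using l by (simp add: field_simps)
  then have 1: "\<phi>2 x + \<phi>1 x / x \<le> ((of_int n)\<^sup>2 / x\<^sup>2 + V x) * \<phi> x" using test by linarith
  have "f x < \<phi> x" using l fx by simp
  then have "(f x)\<^sup>2 \<le> (\<phi> x)\<^sup>2" using fx by (intro power_mono) auto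
  then have "V x \<le> A * ((\<phi> x)\<^sup>2 - T\<^sup>2)" using T(3)[of x] x0 A by (smt (verit) mult_left_mono)
  then have 2: "((of_int n)\<^sup>2 / x\<^sup>2 + V x) * \<phi> x \<le> ((of_int n)\<^sup>2 / x\<^sup>2 + A * ((\<phi> x)\<^sup>2 - T\<^sup>2)) * \<phi> x"
    using \<open>f x < \<phi> x\<close> fx by (intro mult_right_mono) auto
  define y where "y = \<rho>\<^sup>2 / x\<^sup>2"
  have y: "0 < y" "y < 1" using \<rho> x x0 by (auto simp: y_def power_strict_mono)
  have \<phi>y: "\<phi> x = T * (1 - y)\<^sup>2" by (simp add: \<phi>_def y_def)
  have "A * ((\<phi> x)\<^sup>2 - T\<^sup>2) = A * T\<^sup>2 * ((1 - y) ^ 4 - 1)"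
    unfolding \<phi>y by (simp add: algebra_simps power_mult_distrib flip: power_mult)
  also have "\<dots> \<le> A * T\<^sup>2 * (- y)"
  proof (rule mult_left_mono)
    have "(1 - y) ^ 4 \<le> (1 - y) ^ 1" using y by (intro power_decreasing) auto
    then show "(1 - y) ^ 4 - 1 \<le> - y" by simp
  qed (use A in auto)
  \<comment> \<open>The choice of \<open>\<rho>\<close> makes the potential cancel the angular term
    with a surplus of \<open>- 4 / x\<^sup>2\<close>.\<close>
  also have "\<dots> = - ((of_int n)\<^sup>2 + 4) / x\<^sup>2" unfolding \<rho>(2)[symmetric] by (simp add: y_def)
  finally have "(of_int n)\<^sup>2 / x\<^sup>2 + A * ((\<phi> x)\<^sup>2 - T\<^sup>2) \<le> - 4 / x\<^sup>2" by (simp add: add_divide_distrib diff_divide_distrib)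
  then have "((of_int n)\<^sup>2 / x\<^sup>2 + A * ((\<phi> x)\<^sup>2 - T\<^sup>2)) * \<phi> x \<le> - 4 / x\<^sup>2 * \<phi> x"
    using \<open>f x < \<phi> x\<close> fx by (intro mult_right_mono) auto
  with 1 2 have "\<phi>2 x + \<phi>1 x / x \<le> - 4 / x\<^sup>2 * \<phi> x" by linarith
  moreover have "\<phi>2 x + \<phi>1 x / x = T / x\<^sup>2 * (16 * y\<^sup>2 - 8 * y)"
    using x0 by (simp add: \<phi>2_def \<phi>1_def y_def field_simps eval_nat_numeral)
  moreover have "- 4 / x\<^sup>2 * \<phi> x = T / x\<^sup>2 * (- 4 * (1 - y)\<^sup>2)" unfolding \<phi>y by simp
  ultimately have "T / x\<^sup>2 * (16 * y\<^sup>2 - 8 * y) \<le> T / x\<^sup>2 * (- 4 * (1 - y)\<^sup>2)" by (simp only:)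
  then have "16 * y\<^sup>2 - 8 * y \<le> - 4 * (1 - y)\<^sup>2"
    using T x0 by (subst (asm) mult_le_cancel_left_pos) auto
  \<comment> \<open>Five times \<open>20 * y^2 - 16 * y + 4\<close>, with the square
    completed.\<close>
  then have "(10 * y - 4)\<^sup>2 + 4 \<le> 0" by (simp add: power2_eq_square algebra_simps)
  then show False by (smt (verit) zero_le_power2)
qed

text \<open>For decay the size of \<open>f'\<close> matters, so it is not divided by
  \<open>f\<close> here: the coefficient \<open>V + 2 * A * f^2\<close> is bounded below once
  \<open>f\<close> is close enough to \<open>t\<close>, and the source is of order
  \<open>r^(-3)\<close>.\<close>

lemma dddf:
  assumes r: "r > 0"
  defines "u1 \<equiv> ((of_int n)\<^sup>2 / r\<^sup>2 + V r) * f r - deriv f r / r"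
  shows "((\<lambda>r. ((of_int n)\<^sup>2 / r\<^sup>2 + V r) * f r - deriv f r / r) has_real_derivative
     (((of_int n)\<^sup>2 + 1) / r\<^sup>2 + V r + 2 * A * (f r)\<^sup>2) * deriv f r + 2 * B * f r * g r * deriv g r
       - 2 * (of_int n)\<^sup>2 * f r / r ^ 3 - u1 / r) (at r)"
  unfolding u1_def using r
  by (auto intro!: derivative_eq_intros df ddf dV) (simp add: field_simps eval_nat_numeral)

end

text \<open>The radial Laplacian of \<open>M / r^3\<close> is \<open>(12 - 3) * M / r^5\<close>.
  Since \<open>\<bar>v x\<bar> <= \<bar>u x\<bar>\<close>, the coupling is absorbed by
  \<open>\<alpha>\<close>, leaving \<open>4 * c * \<bar>u x\<bar>\<close>. One half of it beats
  \<open>9 * M / x^5\<close>, the other half beats the source.\<close>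

lemma radial_barrier_at_max:
  fixes u v u1 :: "real \<Rightarrow> real"
  assumes x: "0 < x" "a < x" "x < b" "0 \<le> a"
    and max: "\<And>y. a < y \<Longrightarrow> y < b \<Longrightarrow> \<bar>u y\<bar> - M / y ^ 3 \<le> \<bar>u x\<bar> - M / x ^ 3"
    and du: "\<And>y. a < y \<Longrightarrow> (u has_real_derivative u1 y) (at y)"
    and du1: "(u1 has_real_derivative \<alpha> * u x + \<beta> * v x - \<sigma> - u1 x / x) (at x)"
    and coeff: "4 * c + \<bar>\<beta>\<bar> \<le> \<alpha>" "\<bar>\<sigma>\<bar> \<le> S / x ^ 3" "9 / x\<^sup>2 \<le> 2 * c" "S < 2 * c * M" "M > 0" "c > 0"
    and dom: "\<bar>v x\<bar> \<le> \<bar>u x\<bar>" "\<bar>u x\<bar> > M / x ^ 3"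
  shows False
proof -
  \<comment> \<open>The sign is frozen at the touching point, which replaces the modulus by a
    differentiable function.\<close>
  define \<epsilon> :: real where "\<epsilon> = sgn (u x)"
  have "u x \<noteq> 0" using dom x coeff by (smt (verit) divide_nonneg_nonneg zero_le_power)
  then have \<epsilon>: "\<epsilon> * u x = \<bar>u x\<bar>" "\<bar>\<epsilon>\<bar> = 1"
    by (auto simp: \<epsilon>_def sgn_real_def)
  have le: "\<epsilon> * y \<le> \<bar>y\<bar>" for y using \<epsilon>(2) by (metis abs_ge_self abs_mult mult_1)
  have "\<epsilon> * u1 x + 3 * M / x ^ 4 = 0 \<and>
      \<epsilon> * (\<alpha> * u x + \<beta> * v x - \<sigma> - u1 x / x) - 12 * M / x ^ 5 \<le> 0"
  proof (rule second_derivative_at_max[where h = "\<lambda>y. \<epsilon> * u y - M / y ^ 3"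
        and u = "\<lambda>y. \<epsilon> * u1 y + 3 * M / y ^ 4" and x = x and a = a and b = b])
    fix y assume y: "a < y" "y < b"
    show "\<epsilon> * u y - M / y ^ 3 \<le> \<epsilon> * u x - M / x ^ 3"
      using max[OF y] le[of "u y"] \<epsilon>(1) by linarith
    show "((\<lambda>y. \<epsilon> * u y - M / y ^ 3) has_real_derivative \<epsilon> * u1 y + 3 * M / y ^ 4) (at y)"
      using y x by (auto intro!: derivative_eq_intros du simp: field_simps eval_nat_numeral)
  next
    show "((\<lambda>y. \<epsilon> * u1 y + 3 * M / y ^ 4) has_real_derivative
        \<epsilon> * (\<alpha> * u x + \<beta> * v x - \<sigma> - u1 x / x) - 12 * M / x ^ 5) (at x)"
      using x by (auto intro!: derivative_eq_intros du1) (simp add: field_simps eval_nat_numeral)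
  qed (use x in auto)
  then have 1: "\<epsilon> * u1 x = - (3 * M / x ^ 4)"
    and 2: "\<epsilon> * (\<alpha> * u x + \<beta> * v x - \<sigma> - u1 x / x) \<le> 12 * M / x ^ 5" by auto
  have "\<epsilon> * (\<alpha> * u x + \<beta> * v x - \<sigma> - u1 x / x)
      = \<alpha> * (\<epsilon> * u x) + \<epsilon> * (\<beta> * v x) - \<epsilon> * \<sigma> - (\<epsilon> * u1 x) / x" by (simp add: algebra_simps)
  then have "\<alpha> * \<bar>u x\<bar> + \<epsilon> * (\<beta> * v x) - \<epsilon> * \<sigma> + 3 * M / x ^ 4 / x \<le> 12 * M / x ^ 5"
    using 2 unfolding 1 \<epsilon>(1) by simp
  then have "\<alpha> * \<bar>u x\<bar> + \<epsilon> * (\<beta> * v x) - \<epsilon> * \<sigma> + 3 * (M / x ^ 5) \<le> 12 * (M / x ^ 5)"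
    by (simp add: eval_nat_numeral)
  moreover have "\<epsilon> * (\<beta> * v x) \<ge> - (\<bar>\<beta>\<bar> * \<bar>u x\<bar>)"
  proof -
    have "\<epsilon> * - (\<beta> * v x) \<le> \<bar>\<beta>\<bar> * \<bar>v x\<bar>" using le[of "- (\<beta> * v x)"] by (simp add: abs_mult)
    also have "\<dots> \<le> \<bar>\<beta>\<bar> * \<bar>u x\<bar>" using dom by (intro mult_left_mono) auto
    finally show ?thesis by simp
  qed
  moreover have "(4 * c + \<bar>\<beta>\<bar>) * \<bar>u x\<bar> \<le> \<alpha> * \<bar>u x\<bar>" using coeff by (intro mult_right_mono) auto
  then have "4 * (c * \<bar>u x\<bar>) + \<bar>\<beta>\<bar> * \<bar>u x\<bar> \<le> \<alpha> * \<bar>u x\<bar>" by (simp add: algebra_simps)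
  moreover have "\<epsilon> * \<sigma> \<le> S / x ^ 3" using le[of \<sigma>] coeff by linarith
  moreover have "c * \<bar>u x\<bar> \<ge> c * (M / x ^ 3)" using dom coeff by (intro mult_left_mono) auto
  moreover have "9 * (M / x ^ 5) \<le> 2 * (c * (M / x ^ 3))"
  proof -
    have "9 / x\<^sup>2 * (M / x ^ 3) \<le> 2 * c * (M / x ^ 3)" using coeff x by (intro mult_right_mono) auto
    moreover have "9 / x\<^sup>2 * (M / x ^ 3) = 9 * (M / x ^ 5)" by (simp add: eval_nat_numeral)
    ultimately show ?thesis by simp
  qed
  moreover have "S / x ^ 3 < 2 * (c * (M / x ^ 3))"
    using divide_strict_right_mono[OF coeff(4), of "x ^ 3"] x by simp
  moreover have False if "p + q - w + 3 * m \<le> 12 * m" "- b \<le> q" "4 * k + b \<le> p" "w \<le> z" "l \<le> k"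
      "9 * m \<le> 2 * l" "z < 2 * l" for p q w m b k z l :: real
    using that by linarith
  ultimately show False by blast
qed

text \<open>At a maximum of \<open>max \<bar>u\<bar> \<bar>v\<bar> - M / y^3\<close> the larger
  component satisfies the domination hypothesis of \<open>radial_barrier_at_max\<close>. The slack
  \<open>e\<close> in the proof handles the far end, where both functions are known to be small but
  not yet below the barrier.\<close>

lemma radial_system_decay:
  fixes u v u1 v1 \<alpha> \<beta> \<sigma> \<alpha>' \<beta>' \<sigma>' :: "real \<Rightarrow> real"
  assumes R: "R > 0"
    and du: "\<And>y. R \<le> y \<Longrightarrow> (u has_real_derivative u1 y) (at y)"
    and dv: "\<And>y. R \<le> y \<Longrightarrow> (v has_real_derivative v1 y) (at y)"
    and du1: "\<And>y. R \<le> y \<Longrightarrow> (u1 has_real_derivative \<alpha> y * u y + \<beta> y * v y - \<sigma> y - u1 y / y) (at y)"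
    and dv1: "\<And>y. R \<le> y \<Longrightarrow> (v1 has_real_derivative \<alpha>' y * v y + \<beta>' y * u y - \<sigma>' y - v1 y / y) (at y)"
    and coeff: "\<And>y. R \<le> y \<Longrightarrow> 4 * c + \<bar>\<beta> y\<bar> \<le> \<alpha> y" "\<And>y. R \<le> y \<Longrightarrow> 4 * c + \<bar>\<beta>' y\<bar> \<le> \<alpha>' y"
    and src: "\<And>y. R \<le> y \<Longrightarrow> \<bar>\<sigma> y\<bar> \<le> S / y ^ 3" "\<And>y. R \<le> y \<Longrightarrow> \<bar>\<sigma>' y\<bar> \<le> S / y ^ 3"
    and const: "9 / R\<^sup>2 \<le> 2 * c" "S < 2 * c * M" "M > 0" "c > 0"
    and start: "\<bar>u R\<bar> \<le> M / R ^ 3" "\<bar>v R\<bar> \<le> M / R ^ 3"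
    and lim: "(u \<longlongrightarrow> 0) at_top" "(v \<longlongrightarrow> 0) at_top"
    and r: "r \<ge> R"
  shows "\<bar>u r\<bar> \<le> M / r ^ 3 \<and> \<bar>v r\<bar> \<le> M / r ^ 3"
proof -
  let ?w = "\<lambda>y. max \<bar>u y\<bar> \<bar>v y\<bar>"
  have "?w r \<le> M / r ^ 3 + e" if e: "e > 0" for e
  proof (rule ccontr)
    assume neg: "\<not> ?w r \<le> M / r ^ 3 + e"
    let ?h = "\<lambda>y. ?w y - M / y ^ 3"
    have "\<forall>\<^sub>F y in at_top. \<bar>u y\<bar> < e \<and> \<bar>v y\<bar> < e \<and> y \<ge> r"
      using tendstoD[OF lim(1) e] tendstoD[OF lim(2) e] eventually_ge_at_top[of r]
      by (simp add: eventually_conj_iff)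
    then obtain b where b: "\<bar>u b\<bar> < e" "\<bar>v b\<bar> < e" "b \<ge> r" by (auto simp: eventually_at_top_linorder)
    obtain x where x: "R < x" "x < b" "?h x > e" "\<And>y. R \<le> y \<Longrightarrow> y \<le> b \<Longrightarrow> ?h y \<le> ?h x"
    proof (rule interior_max[of R b ?h e r])
      have "isCont ?h y" if "y \<ge> R" for y
        using DERIV_isCont[OF du[OF that]] DERIV_isCont[OF dv[OF that]] that R
        by (intro continuous_intros) auto
      then show "continuous_on {R..b} ?h" by (intro continuous_at_imp_continuous_on) auto
      show "?h R \<le> e" using start e by simp
      have "M / b ^ 3 > 0" using const b r R by simp
      then show "?h b \<le> e" using b by (simp add: max_def)
      show "e < ?h r" using neg by linarith
      show "r \<in> {R..b}" using b r by simp
    qed (rule that)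
    have Rx: "R \<le> x" using x(1) by simp
    have x0: "x > 0" using x R by simp
    have x9: "9 / x\<^sup>2 \<le> 2 * c"
    proof -
      have "R\<^sup>2 \<le> x\<^sup>2" using x R by (intro power_mono) auto
      then have "9 / x\<^sup>2 \<le> 9 / R\<^sup>2" using R x0 by (intro divide_left_mono) auto
      then show ?thesis using const by simp
    qed
    have big: "?w x > M / x ^ 3" using x(3) e by linarith
    show False
    proof (cases "\<bar>v x\<bar> \<le> \<bar>u x\<bar>")
      case True
      show False
      proof (rule radial_barrier_at_max[of x R b u M u1 "\<alpha> x" "\<beta> x" v "\<sigma> x" c S,
          OF x0 x(1,2) _ _ _ du1[OF Rx] coeff(1)[OF Rx] src(1)[OF Rx] x9 const(2-4)])
        fix y assume "R < y" "y < b"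
        then have "?h y \<le> ?h x" by (intro x(4)) auto
        moreover have "\<bar>u y\<bar> \<le> ?w y" "?w x = \<bar>u x\<bar>" using True by auto
        ultimately show "\<bar>u y\<bar> - M / y ^ 3 \<le> \<bar>u x\<bar> - M / x ^ 3" by linarith
      next
        show "(u has_real_derivative u1 y) (at y)" if "R < y" for y using that by (intro du) simp
      qed (use True big R in auto)
    next
      case False
      show False
      proof (rule radial_barrier_at_max[of x R b v M v1 "\<alpha>' x" "\<beta>' x" u "\<sigma>' x" c S,
          OF x0 x(1,2) _ _ _ dv1[OF Rx] coeff(2)[OF Rx] src(2)[OF Rx] x9 const(2-4)])
        fix y assume "R < y" "y < b"
        then have "?h y \<le> ?h x" by (intro x(4)) auto
        moreover have "\<bar>v y\<bar> \<le> ?w y" "?w x = \<bar>v x\<bar>" using False by auto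
        ultimately show "\<bar>v y\<bar> - M / y ^ 3 \<le> \<bar>v x\<bar> - M / x ^ 3" by linarith
      next
        show "(v has_real_derivative v1 y) (at y)" if "R < y" for y using that by (intro dv) simp
      qed (use False big R in auto)
    qed
  qed
  then have "?w r \<le> M / r ^ 3" by (rule field_le_epsilon)
  then show ?thesis by simp
qed

section \<open>Decay of pairs with constants independent of the coupling\<close>

lemma (in radial_component) V_bound:
  assumes A: "A > 0" "B \<ge> 0" and F: "F \<ge> 0" "t\<^sup>2 \<le> F\<^sup>2" "s\<^sup>2 \<le> F\<^sup>2" "B * F\<^sup>2 \<le> A * F\<^sup>2"
    and f: "\<forall>r\<ge>0. f r \<le> F" and g: "\<forall>r\<ge>0. 0 \<le> g r \<and> g r \<le> F"
    and r: "r \<ge> 0"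
  shows "\<bar>V r\<bar> \<le> 2 * A * F\<^sup>2" "V r \<le> A * ((f r)\<^sup>2 - t\<^sup>2) + B * F\<^sup>2"
    "V r \<ge> A * ((f r)\<^sup>2 - t\<^sup>2) - B * F\<^sup>2"
proof -
  have sq: "(f r)\<^sup>2 \<le> F\<^sup>2" "(g r)\<^sup>2 \<le> F\<^sup>2" using f g f_nonneg r by (auto intro!: power_mono)
  have "\<bar>(f r)\<^sup>2 - t\<^sup>2\<bar> \<le> F\<^sup>2" "\<bar>(g r)\<^sup>2 - s\<^sup>2\<bar> \<le> F\<^sup>2"
    using sq F zero_le_power2[of "f r"] zero_le_power2[of "g r"] zero_le_power2[of t] zero_le_power2[of s]
    by linarith+
  then have "\<bar>A * ((f r)\<^sup>2 - t\<^sup>2)\<bar> \<le> A * F\<^sup>2" "\<bar>B * ((g r)\<^sup>2 - s\<^sup>2)\<bar> \<le> B * F\<^sup>2"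
    using A by (simp_all add: abs_mult mult_left_mono)
  then show "\<bar>V r\<bar> \<le> 2 * A * F\<^sup>2" "V r \<le> A * ((f r)\<^sup>2 - t\<^sup>2) + B * F\<^sup>2"
    "V r \<ge> A * ((f r)\<^sup>2 - t\<^sup>2) - B * F\<^sup>2" unfolding V_def using F(4) by linarith+
qed

text \<open>The radius is tied to the data only and not to the solution, which the limit at infinity
  could not provide.\<close>

lemma (in radial_component) f_square_lower:
  assumes A: "A > 0" "B \<ge> 0" and F: "F \<ge> 0" "t\<^sup>2 \<le> F\<^sup>2" "s\<^sup>2 \<le> F\<^sup>2" "B * F\<^sup>2 \<le> A * F\<^sup>2" "16 * (B * F\<^sup>2) \<le> A * t\<^sup>2"
    and f: "\<forall>r\<ge>0. f r \<le> F" and g: "\<forall>r\<ge>0. 0 \<le> g r \<and> g r \<le> F"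
    and R: "R > 0" "200 * ((of_int n)\<^sup>2 + 4) \<le> A * t\<^sup>2 * R\<^sup>2" and r: "r \<ge> R"
  shows "t\<^sup>2 / 2 \<le> (f r)\<^sup>2"
proof -
  \<comment> \<open>\<open>T^2 = 9/16 * t^2\<close> leaves \<open>7/16 * A * t^2\<close> to absorb
    \<open>B * F^2\<close>. Since 1600/9 < 200, the hypothesis on \<open>R\<close> gives
    \<open>\<rho>^2 / r^2 <= 1/100\<close>, and \<open>9/16 * (99/100)^4\<close> still exceeds
    1/2.\<close>
  define T where "T = 3 * t / 4"
  define \<rho> where "\<rho> = sqrt (((of_int n)\<^sup>2 + 4) / (A * T\<^sup>2))"
  have T: "0 < T" "T < t" "T\<^sup>2 = 9 / 16 * t\<^sup>2" using t_pos by (auto simp: T_def power2_eq_square)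
  have n4: "(of_int n)\<^sup>2 + 4 > (0::real)" by (simp add: add_nonneg_pos)
  have \<rho>: "\<rho> > 0" "\<rho>\<^sup>2 = ((of_int n)\<^sup>2 + 4) / (A * T\<^sup>2)"
    using A T n4 by (auto simp: \<rho>_def)
  have "A * T\<^sup>2 * \<rho>\<^sup>2 = (of_int n)\<^sup>2 + 4" using \<rho> A T(1) by simp
  have r0: "r > 0" using r R by simp
  have "100 * \<rho>\<^sup>2 \<le> r\<^sup>2"
  proof -
    have "A * t\<^sup>2 * (100 * \<rho>\<^sup>2) = 1600 / 9 * ((of_int n)\<^sup>2 + 4)" using \<rho>(2) A t_pos unfolding T(3) by simp
    also have "\<dots> \<le> 200 * ((of_int n)\<^sup>2 + 4)" using n4 by (intro mult_right_mono) auto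
    also have "\<dots> \<le> A * t\<^sup>2 * R\<^sup>2" by (rule R)
    finally have "100 * \<rho>\<^sup>2 \<le> R\<^sup>2" using A t_pos by simp
    also have "\<dots> \<le> r\<^sup>2" using r R by (intro power_mono) auto
    finally show ?thesis .
  qed
  then have y: "\<rho>\<^sup>2 / r\<^sup>2 \<le> 1 / 100" using r0 by (simp add: field_simps)
  have "\<rho>\<^sup>2 \<le> r\<^sup>2" using \<open>100 * \<rho>\<^sup>2 \<le> r\<^sup>2\<close> zero_le_power2[of \<rho>] by linarith
  then have "\<rho> \<le> r" by (rule power2_le_imp_le) (use r0 in simp)
  have "T * (1 - \<rho>\<^sup>2 / r\<^sup>2)\<^sup>2 \<le> f r"
  proof (rule f_lower_bound[OF A(1) T(1,2) _ \<rho>(1) _ \<open>\<rho> \<le> r\<close>])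
    fix x :: real assume x: "x \<ge> 0"
    have "V x \<le> A * ((f x)\<^sup>2 - t\<^sup>2) + B * F\<^sup>2" by (rule V_bound(2)[OF A F(1-4) f g x])
    also have "\<dots> \<le> A * ((f x)\<^sup>2 - T\<^sup>2)"
    proof -
      have "A * t\<^sup>2 \<ge> 0" using A by simp
      then show ?thesis using F(5) unfolding T(3) by (simp add: algebra_simps)
    qed
    finally show "V x \<le> A * ((f x)\<^sup>2 - T\<^sup>2)" .
  qed fact
  moreover have "(99/100)\<^sup>2 \<le> (1 - \<rho>\<^sup>2 / r\<^sup>2)\<^sup>2" using y by (intro power_mono) auto
  then have "T * (99/100)\<^sup>2 \<le> T * (1 - \<rho>\<^sup>2 / r\<^sup>2)\<^sup>2" using T by (intro mult_left_mono) auto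
  ultimately have "T * (99/100)\<^sup>2 \<le> f r" by linarith
  then have "(T * (99/100)\<^sup>2)\<^sup>2 \<le> (f r)\<^sup>2" using T by (intro power_mono) auto
  moreover have "(T * (99/100)\<^sup>2)\<^sup>2 = t\<^sup>2 * (9 / 16 * (99/100) ^ 4)" unfolding power_mult_distrib T(3)
    by (simp flip: power_mult)
  moreover have "t\<^sup>2 * (1 / 2) \<le> t\<^sup>2 * (9 / 16 * (99/100) ^ 4)" by (intro mult_left_mono) (auto simp: eval_nat_numeral)
  ultimately show ?thesis by simp
qed

text \<open>Up to \<open>R\<close> the bound comes from \<open>deriv_bound\<close>, beyond
  \<open>R\<close> from the barrier for the system of \<open>f'\<close> and \<open>g'\<close>. The
  hypotheses collect what the constants must satisfy.\<close>

lemma (in radial_pair) deriv_decay: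
  assumes A: "A > 0" "A' > 0" and B: "B \<ge> 0" "B \<le> A" "B \<le> A'"
    and n: "n \<noteq> 0" "m \<noteq> 0"
    and F: "F \<ge> 0" "F\<^sup>2 = t\<^sup>2 + s\<^sup>2" and BF: "16 * (B * F\<^sup>2) \<le> A * t\<^sup>2" "16 * (B * F\<^sup>2) \<le> A' * s\<^sup>2"
    and c: "c > 0" "16 * c \<le> A * t\<^sup>2" "16 * c \<le> A' * s\<^sup>2"
    and N: "(of_int n)\<^sup>2 \<le> N" "(of_int m)\<^sup>2 \<le> N" and D: "2 * A * F\<^sup>2 \<le> D" "2 * A' * F\<^sup>2 \<le> D"
    and R: "R > 0" "9 / R\<^sup>2 \<le> 2 * c" "200 * (N + 4) \<le> A * t\<^sup>2 * R\<^sup>2" "200 * (N + 4) \<le> A' * s\<^sup>2 * R\<^sup>2"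
    and M: "M > 0" "2 * N * F < 2 * c * M" "R ^ 3 * ((N + R\<^sup>2 * D) * (F + D * F / 3)) \<le> M"
    and r: "r > 0"
  shows "r ^ 3 * \<bar>deriv f r\<bar> \<le> M \<and> r ^ 3 * \<bar>deriv g r\<bar> \<le> M" "f r \<le> F" "g r \<le> F"
proof -
  have F2: "t\<^sup>2 \<le> F\<^sup>2" "s\<^sup>2 \<le> F\<^sup>2" using F by auto
  have BA: "B * F\<^sup>2 \<le> A * F\<^sup>2" "B * F\<^sup>2 \<le> A' * F\<^sup>2" using B by (auto intro!: mult_right_mono)
  have tF: "t\<^sup>2 + B * s\<^sup>2 / A \<le> F\<^sup>2" "s\<^sup>2 + B * t\<^sup>2 / A' \<le> F\<^sup>2"
    using A mult_right_mono[OF B(2), of "s\<^sup>2"] mult_right_mono[OF B(3), of "t\<^sup>2"]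
    unfolding F by (simp_all add: field_simps)
  have f: "\<forall>x\<ge>0. f x \<le> F" using P.f_upper_bound[OF A(1) B(1) n(1) F(1) tF(1)] by blast
  have g: "\<forall>x\<ge>0. g x \<le> F" using Q.f_upper_bound[OF A(2) B(1) n(2) F(1) tF(2)] by blast
  have f0: "\<forall>x\<ge>0. 0 \<le> f x \<and> f x \<le> F" using f P.f_nonneg by simp
  have g0: "\<forall>x\<ge>0. 0 \<le> g x \<and> g x \<le> F" using g Q.f_nonneg by simp
  note Vf = P.V_bound[OF A(1) B(1) F(1) F2 BA(1) f g0] and Vg = Q.V_bound[OF A(2) B(1) F(1) F2(2,1) BA(2) g f0]
  have D0: "D \<ge> 0" using D(1) A by (smt (verit) mult_nonneg_nonneg zero_le_power2)
  have VD: "\<forall>x\<ge>0. \<bar>P.V x\<bar> \<le> D" "\<forall>x\<ge>0. \<bar>Q.V x\<bar> \<le> D"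
    using Vf(1) Vg(1) D by (auto intro: order_trans)
  have inner: "\<bar>deriv f x\<bar> \<le> M / R ^ 3" "\<bar>deriv g x\<bar> \<le> M / R ^ 3" if x: "0 < x" "x \<le> R" for x
  proof -
    have "(N + R\<^sup>2 * D) * (F + D * F / 3) \<le> M / R ^ 3" using M(3) R by (simp add: field_simps)
    then show "\<bar>deriv f x\<bar> \<le> M / R ^ 3" "\<bar>deriv g x\<bar> \<le> M / R ^ 3"
      using P.deriv_bound[OF n(1) f D0 VD(1) N(1) x] Q.deriv_bound[OF n(2) g D0 VD(2) N(2) x] by auto
  qed
  have outer: "\<bar>deriv f x\<bar> \<le> M / x ^ 3 \<and> \<bar>deriv g x\<bar> \<le> M / x ^ 3" if x: "x \<ge> R" for x
  proof (rule radial_system_decay[where c = c and S = "2 * N * F" and R = R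
      and ?u1.0 = "\<lambda>r. ((of_int n)\<^sup>2 / r\<^sup>2 + P.V r) * f r - deriv f r / r"
      and ?v1.0 = "\<lambda>r. ((of_int m)\<^sup>2 / r\<^sup>2 + Q.V r) * g r - deriv g r / r"
      and \<alpha> = "\<lambda>r. ((of_int n)\<^sup>2 + 1) / r\<^sup>2 + P.V r + 2 * A * (f r)\<^sup>2"
      and \<alpha>' = "\<lambda>r. ((of_int m)\<^sup>2 + 1) / r\<^sup>2 + Q.V r + 2 * A' * (g r)\<^sup>2"
      and \<beta> = "\<lambda>r. 2 * B * f r * g r" and \<beta>' = "\<lambda>r. 2 * B * g r * f r"
      and \<sigma> = "\<lambda>r. 2 * (of_int n)\<^sup>2 * f r / r ^ 3" and \<sigma>' = "\<lambda>r. 2 * (of_int m)\<^sup>2 * g r / r ^ 3"])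
    fix y assume y: "R \<le> y"
    then have y0: "y > 0" using R by simp
    then have y0': "y \<ge> 0" by simp
    show "(deriv f has_real_derivative ((of_int n)\<^sup>2 / y\<^sup>2 + P.V y) * f y - deriv f y / y) (at y)"
      "(deriv g has_real_derivative ((of_int m)\<^sup>2 / y\<^sup>2 + Q.V y) * g y - deriv g y / y) (at y)"
      by (rule P.ddf Q.ddf y0)+
    show "((\<lambda>r. ((of_int n)\<^sup>2 / r\<^sup>2 + P.V r) * f r - deriv f r / r) has_real_derivative
      (((of_int n)\<^sup>2 + 1) / y\<^sup>2 + P.V y + 2 * A * (f y)\<^sup>2) * deriv f y + 2 * B * f y * g y * deriv g y
        - 2 * (of_int n)\<^sup>2 * f y / y ^ 3 - (((of_int n)\<^sup>2 / y\<^sup>2 + P.V y) * f y - deriv f y / y) / y) (at y)"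
      by (rule P.dddf[OF y0])
    show "((\<lambda>r. ((of_int m)\<^sup>2 / r\<^sup>2 + Q.V r) * g r - deriv g r / r) has_real_derivative
      (((of_int m)\<^sup>2 + 1) / y\<^sup>2 + Q.V y + 2 * A' * (g y)\<^sup>2) * deriv g y + 2 * B * g y * f y * deriv f y
        - 2 * (of_int m)\<^sup>2 * g y / y ^ 3 - (((of_int m)\<^sup>2 / y\<^sup>2 + Q.V y) * g y - deriv g y / y) / y) (at y)"
      by (rule Q.dddf[OF y0])
    have fg: "0 \<le> f y * g y" "f y * g y \<le> F\<^sup>2"
      using f0[rule_format, OF y0'] g0[rule_format, OF y0'] unfolding power2_eq_square by (auto intro!: mult_mono)
    have \<beta>: "\<bar>2 * B * f y * g y\<bar> \<le> 2 * (B * F\<^sup>2)"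
    proof -
      have "2 * B * f y * g y = 2 * (B * (f y * g y))" by simp
      moreover have "0 \<le> B * (f y * g y)" "B * (f y * g y) \<le> B * F\<^sup>2" using fg B by (auto intro!: mult_left_mono)
      ultimately show ?thesis by simp
    qed
    have \<beta>': "\<bar>2 * B * g y * f y\<bar> \<le> 2 * (B * F\<^sup>2)" using \<beta> by (simp add: mult_ac)
    have "200 * ((of_int n)\<^sup>2 + 4) \<le> A * t\<^sup>2 * R\<^sup>2" "200 * ((of_int m)\<^sup>2 + 4) \<le> A' * s\<^sup>2 * R\<^sup>2"
      using N by (auto intro!: order_trans[OF _ R(3)] order_trans[OF _ R(4)])
    then have "t\<^sup>2 / 2 \<le> (f y)\<^sup>2" "s\<^sup>2 / 2 \<le> (g y)\<^sup>2"
      using P.f_square_lower[OF A(1) B(1) F(1) F2 BA(1) BF(1) f g0 R(1) _ y]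
        Q.f_square_lower[OF A(2) B(1) F(1) F2(2,1) BA(2) BF(2) g f0 R(1) _ y] by auto
    then have sq: "A * (t\<^sup>2 / 2) \<le> A * (f y)\<^sup>2" "A' * (s\<^sup>2 / 2) \<le> A' * (g y)\<^sup>2"
      using A by (auto intro!: mult_left_mono)
    have pos: "((of_int n)\<^sup>2 + 1) / y\<^sup>2 \<ge> (0::real)" "((of_int m)\<^sup>2 + 1) / y\<^sup>2 \<ge> (0::real)" by auto
    \<comment> \<open>The budget, with \<open>\<tau>\<close> for \<open>A * t^2\<close>,
      \<open>w\<close> for \<open>B * F^2\<close> and \<open>z\<close> for \<open>A * f^2\<close>:
      the right side is at least \<open>3 * z - \<tau> - w >= 7/16 * \<tau>\<close>, the left side
      at most \<open>\<tau> / 4 + \<tau> / 8\<close>.\<close>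
    have total: "4 * k + \<gamma> \<le> p + V + 2 * z"
      if "\<gamma> \<le> 2 * w" "z - \<tau> - w \<le> V" "\<tau> / 2 \<le> z" "0 \<le> p" "16 * k \<le> \<tau>" "16 * w \<le> \<tau>" "0 \<le> \<tau>"
      for k \<gamma> p V z \<tau> w :: real
      using that by linarith
    show "4 * c + \<bar>2 * B * f y * g y\<bar> \<le> ((of_int n)\<^sup>2 + 1) / y\<^sup>2 + P.V y + 2 * A * (f y)\<^sup>2"
      unfolding mult.assoc[of 2 A]
      by (rule total[OF \<beta> _ _ pos(1) c(2) BF(1) order_trans[OF _ c(2)]]) (use Vf(3)[OF y0'] sq(1) c(1) in \<open>simp_all add: right_diff_distrib\<close>)
    show "4 * c + \<bar>2 * B * g y * f y\<bar> \<le> ((of_int m)\<^sup>2 + 1) / y\<^sup>2 + Q.V y + 2 * A' * (g y)\<^sup>2"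
      unfolding mult.assoc[of 2 A']
      by (rule total[OF \<beta>' _ _ pos(2) c(3) BF(2) order_trans[OF _ c(3)]]) (use Vg(3)[OF y0'] sq(2) c(1) in \<open>simp_all add: right_diff_distrib\<close>)
    have "\<bar>2 * (of_int n)\<^sup>2 * f y\<bar> \<le> 2 * N * F" "\<bar>2 * (of_int m)\<^sup>2 * g y\<bar> \<le> 2 * N * F"
      using f0[rule_format, OF y0'] g0[rule_format, OF y0'] N order_trans[OF zero_le_power2 N(1)]
      by (auto simp: abs_mult intro!: mult_mono)
    then show "\<bar>2 * (of_int n)\<^sup>2 * f y / y ^ 3\<bar> \<le> 2 * N * F / y ^ 3"
      "\<bar>2 * (of_int m)\<^sup>2 * g y / y ^ 3\<bar> \<le> 2 * N * F / y ^ 3"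
      using y0 by (simp_all add: divide_right_mono)
  qed (use R M c inner P.deriv_limit Q.deriv_limit x in auto)
  show "r ^ 3 * \<bar>deriv f r\<bar> \<le> M \<and> r ^ 3 * \<bar>deriv g r\<bar> \<le> M"
  proof (cases "r \<le> R")
    case True
    have "r ^ 3 * z \<le> M" if "0 \<le> z" "z \<le> M / R ^ 3" for z
    proof -
      have "r ^ 3 * z \<le> R ^ 3 * (M / R ^ 3)" using that True r by (intro mult_mono power_mono) auto
      then show ?thesis using R by simp
    qed
    then show ?thesis using inner[OF r True] by simp
  next
    case False
    then show ?thesis using outer[of r] r by (simp add: pos_le_divide_eq mult.commute)
  qed
  show "f r \<le> F" "g r \<le> F" using f g r by auto
qed

text \<open>Every constant is fixed from the coefficients, limit values and degrees before
  \<open>B\<close> and the solution are introduced. The factor \<open>f\<close> is included since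
  the coupling term contains \<open>f * f'\<close>; it costs the upper bound
  \<open>F\<close>.\<close>

lemma uniform_deriv_decay:
  fixes A A' t s :: real and n m :: int
  assumes A: "A > 0" "A' > 0" and ts: "t > 0" "s > 0" and n: "n \<noteq> 0" "m \<noteq> 0"
  obtains B1 C where "B1 > 0" "C > 0"
    "\<And>B f g r. 0 \<le> B \<Longrightarrow> B \<le> B1 \<Longrightarrow> radial_pair A A' t B s n m f g \<Longrightarrow> r > 0 \<Longrightarrow>
       r ^ 3 * \<bar>f r * deriv f r\<bar> \<le> C \<and> r ^ 3 * \<bar>g r * deriv g r\<bar> \<le> C"
proof -
  define a where "a = min (A * t\<^sup>2) (A' * s\<^sup>2)"
  have a: "a > 0" "a \<le> A * t\<^sup>2" "a \<le> A' * s\<^sup>2" using A ts by (auto simp: a_def)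
  define F where "F = sqrt (t\<^sup>2 + s\<^sup>2)"
  have F: "F > 0" "F\<^sup>2 = t\<^sup>2 + s\<^sup>2" using ts by (auto simp: F_def add_pos_pos)
  \<comment> \<open>The first two entries make \<open>F\<close> an upper bound for both profiles;
    the third gives \<open>16 * (B * F\<^sup>2) <= a\<close>.\<close>
  define B1 where "B1 = min (min A A') (a / (16 * F\<^sup>2))"
  have B1: "B1 > 0" using A a F(1) by (simp add: B1_def)
  define c where "c = a / 16"
  define N :: real where "N = (of_int n)\<^sup>2 + (of_int m)\<^sup>2"
  have N0: "N \<ge> 0" by (simp add: N_def)
  define D where "D = 2 * A * F\<^sup>2 + 2 * A' * F\<^sup>2"
  have D0: "D \<ge> 0" using A by (simp add: D_def)
  \<comment> \<open>The conditions concern \<open>R^2\<close>; the summand 1 ensures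
    \<open>R <= R^2\<close>, so it suffices to meet them linearly.\<close>
  define R where "R = 1 + 9 / (2 * c) + 200 * (N + 4) / a"
  have c: "c > 0" using a by (simp add: c_def)
  have R: "R \<ge> 1" "R \<ge> 9 / (2 * c)" "R \<ge> 200 * (N + 4) / a" using c N0 a by (auto simp: R_def)
  have R2: "R \<le> R\<^sup>2" using R(1) by (simp add: power2_eq_square)
  \<comment> \<open>The first summand covers the inner region, the second balances the source
    \<open>2 * N * F\<close> against \<open>2 * c * M\<close>, and 1 makes that inequality
    strict.\<close>
  define M where "M = R ^ 3 * ((N + R\<^sup>2 * D) * (F + D * F / 3)) + N * F / c + 1"
  have M: "M > 0" "2 * N * F < 2 * c * M" "R ^ 3 * ((N + R\<^sup>2 * D) * (F + D * F / 3)) \<le> M"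
  proof -
    have p: "R ^ 3 * ((N + R\<^sup>2 * D) * (F + D * F / 3)) \<ge> 0" using R N0 D0 F by simp
    moreover have q: "N * F / c \<ge> 0" using N0 F c by simp
    ultimately show "M > 0" "R ^ 3 * ((N + R\<^sup>2 * D) * (F + D * F / 3)) \<le> M" by (auto simp: M_def)
    have "N * F / c < M" using p by (simp add: M_def)
    then show "2 * N * F < 2 * c * M" using c by (simp add: field_simps)
  qed
  show ?thesis
  proof (rule that[of B1 "F * M"])
    show "B1 > 0" "F * M > 0" using B1 F M by auto
    fix B f g r
    assume B: "0 \<le> B" "B \<le> B1" and pair: "radial_pair A A' t B s n m f g" and r: "(r::real) > 0"
    interpret radial_pair A A' t B s n m f g by (rule pair)
    have "B * F\<^sup>2 \<le> a / 16" using B F(1) by (simp add: B1_def field_simps)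
    then have BF: "16 * (B * F\<^sup>2) \<le> A * t\<^sup>2" "16 * (B * F\<^sup>2) \<le> A' * s\<^sup>2" using a by linarith+
    have R9: "9 / R\<^sup>2 \<le> 2 * c"
    proof -
      have "9 \<le> R * (2 * c)" using R(2) c by (simp add: pos_divide_le_eq)
      also have "\<dots> \<le> R\<^sup>2 * (2 * c)" using R2 c by (intro mult_right_mono) auto
      finally show ?thesis using R(1) by (simp add: pos_divide_le_eq mult.commute)
    qed
    have R200: "200 * (N + 4) \<le> A * t\<^sup>2 * R\<^sup>2" "200 * (N + 4) \<le> A' * s\<^sup>2 * R\<^sup>2"
    proof -
      have "200 * (N + 4) \<le> a * R" using R(3) a by (simp add: pos_divide_le_eq mult.commute)
      also have "\<dots> \<le> a * R\<^sup>2" using R2 a by (intro mult_left_mono) auto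
      finally have "200 * (N + 4) \<le> a * R\<^sup>2" .
      moreover have "a * R\<^sup>2 \<le> A * t\<^sup>2 * R\<^sup>2" "a * R\<^sup>2 \<le> A' * s\<^sup>2 * R\<^sup>2" using a by (auto intro!: mult_right_mono)
      ultimately show "200 * (N + 4) \<le> A * t\<^sup>2 * R\<^sup>2" "200 * (N + 4) \<le> A' * s\<^sup>2 * R\<^sup>2" by linarith+
    qed
    have c16: "16 * c \<le> A * t\<^sup>2" "16 * c \<le> A' * s\<^sup>2" using a by (auto simp: c_def)
    have nN: "(of_int n)\<^sup>2 \<le> N" "(of_int m)\<^sup>2 \<le> N" by (auto simp: N_def)
    have DD: "2 * A * F\<^sup>2 \<le> D" "2 * A' * F\<^sup>2 \<le> D" using A by (auto simp: D_def)
    have BA: "B \<le> A" "B \<le> A'" using B by (auto simp: B1_def)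
    have F0: "F \<ge> 0" "R > 0" using F R by auto
    note d = deriv_decay[OF A B(1) BA n F0(1) F(2) BF c c16 nN DD F0(2) R9 R200 M r]
    have "r ^ 3 * \<bar>z * w\<bar> \<le> F * M" if "0 \<le> z" "z \<le> F" "r ^ 3 * \<bar>w\<bar> \<le> M" for z w
    proof -
      have "r ^ 3 * \<bar>z * w\<bar> = z * (r ^ 3 * \<bar>w\<bar>)" using that by (simp add: abs_mult)
      also have "\<dots> \<le> F * M" using that F r by (intro mult_mono) auto
      finally show ?thesis .
    qed
    then show "r ^ 3 * \<bar>f r * deriv f r\<bar> \<le> F * M \<and> r ^ 3 * \<bar>g r * deriv g r\<bar> \<le> F * M"
      using d P.f_nonneg[of r] Q.f_nonneg[of r] r by auto
  qed
qed

section \<open>From solutions of the radial problem to the three monotonicity statements\<close>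

lemma radial_solution_imp_pair:
  assumes "radial_solution A A' t s B n m f g" "t > 0" "s > 0"
  shows "radial_pair A A' t B s n m f g"
  unfolding radial_pair_def radial_component_def
  using assms by (auto simp: radial_solution_def radial_equation_def radial_boundary_conditions_def)

theorem theorem1p2:
  fixes A\<^sub>p A\<^sub>m t\<^sub>p t\<^sub>m :: real
  assumes "A\<^sub>p > 0" and "A\<^sub>m > 0" and "t\<^sub>p > 0" and "t\<^sub>m > 0"
  shows "(\<forall>B n\<^sub>p n\<^sub>m f\<^sub>p f\<^sub>m.
            B\<^sup>2 < A\<^sub>p * A\<^sub>m \<longrightarrow> B < 0 \<longrightarrow>
            radial_solution A\<^sub>p A\<^sub>m t\<^sub>p t\<^sub>m B n\<^sub>p n\<^sub>m f\<^sub>p f\<^sub>m \<longrightarrow>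
            (\<forall>r>0. deriv f\<^sub>p r \<ge> 0 \<and> deriv f\<^sub>m r \<ge> 0)) \<and>
         (\<forall>B n\<^sub>p n\<^sub>m f\<^sub>p f\<^sub>m.
            B\<^sup>2 < A\<^sub>p * A\<^sub>m \<longrightarrow> B > 0 \<longrightarrow> n\<^sub>p \<ge> 1 \<longrightarrow> n\<^sub>m = 0 \<longrightarrow>
            radial_solution A\<^sub>p A\<^sub>m t\<^sub>p t\<^sub>m B n\<^sub>p n\<^sub>m f\<^sub>p f\<^sub>m \<longrightarrow>
            (\<forall>r>0. deriv f\<^sub>p r \<ge> 0 \<and> deriv f\<^sub>m r \<le> 0)) \<and>
         (\<forall>n\<^sub>p n\<^sub>m. n\<^sub>p \<noteq> 0 \<longrightarrow> n\<^sub>m \<noteq> 0 \<longrightarrow>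
            (\<exists>B\<^sub>0>0. \<forall>B f\<^sub>p f\<^sub>m.
               B\<^sup>2 < A\<^sub>p * A\<^sub>m \<longrightarrow> 0 \<le> B \<longrightarrow> B \<le> B\<^sub>0 \<longrightarrow>
               radial_solution A\<^sub>p A\<^sub>m t\<^sub>p t\<^sub>m B n\<^sub>p n\<^sub>m f\<^sub>p f\<^sub>m \<longrightarrow>
               (\<forall>r>0. deriv f\<^sub>p r \<ge> 0 \<and> deriv f\<^sub>m r \<ge> 0)))"
proof (intro conjI)
  show "\<forall>B n\<^sub>p n\<^sub>m f\<^sub>p f\<^sub>m. B\<^sup>2 < A\<^sub>p * A\<^sub>m \<longrightarrow> B < 0 \<longrightarrow>
      radial_solution A\<^sub>p A\<^sub>m t\<^sub>p t\<^sub>m B n\<^sub>p n\<^sub>m f\<^sub>p f\<^sub>m \<longrightarrow>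
      (\<forall>r>0. deriv f\<^sub>p r \<ge> 0 \<and> deriv f\<^sub>m r \<ge> 0)"
    using radial_pair.deriv_nonneg_of_negative_coupling[OF radial_solution_imp_pair] assms
    by (metis less_imp_le)
  show "\<forall>B n\<^sub>p n\<^sub>m f\<^sub>p f\<^sub>m. B\<^sup>2 < A\<^sub>p * A\<^sub>m \<longrightarrow> B > 0 \<longrightarrow> n\<^sub>p \<ge> 1 \<longrightarrow> n\<^sub>m = 0 \<longrightarrow>
      radial_solution A\<^sub>p A\<^sub>m t\<^sub>p t\<^sub>m B n\<^sub>p n\<^sub>m f\<^sub>p f\<^sub>m \<longrightarrow>
      (\<forall>r>0. deriv f\<^sub>p r \<ge> 0 \<and> deriv f\<^sub>m r \<le> 0)"
    using radial_pair.deriv_signs_of_positive_coupling[OF radial_solution_imp_pair] assms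
    by (metis less_imp_le)
  show "\<forall>n\<^sub>p n\<^sub>m. n\<^sub>p \<noteq> 0 \<longrightarrow> n\<^sub>m \<noteq> 0 \<longrightarrow>
      (\<exists>B\<^sub>0>0. \<forall>B f\<^sub>p f\<^sub>m. B\<^sup>2 < A\<^sub>p * A\<^sub>m \<longrightarrow> 0 \<le> B \<longrightarrow> B \<le> B\<^sub>0 \<longrightarrow>
         radial_solution A\<^sub>p A\<^sub>m t\<^sub>p t\<^sub>m B n\<^sub>p n\<^sub>m f\<^sub>p f\<^sub>m \<longrightarrow>
         (\<forall>r>0. deriv f\<^sub>p r \<ge> 0 \<and> deriv f\<^sub>m r \<ge> 0))"
  proof (intro allI impI)
    fix n m :: int assume n: "n \<noteq> 0" "m \<noteq> 0"
    obtain B1 C where B1: "B1 > 0" "C > 0" and decay: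
      "\<And>B f g r. 0 \<le> B \<Longrightarrow> B \<le> B1 \<Longrightarrow> radial_pair A\<^sub>p A\<^sub>m t\<^sub>p B t\<^sub>m n m f g \<Longrightarrow> r > 0 \<Longrightarrow>
       r ^ 3 * \<bar>f r * deriv f r\<bar> \<le> C \<and> r ^ 3 * \<bar>g r * deriv g r\<bar> \<le> C"
      using uniform_deriv_decay[OF assms n] by blast
    show "\<exists>B\<^sub>0>0. \<forall>B f\<^sub>p f\<^sub>m. B\<^sup>2 < A\<^sub>p * A\<^sub>m \<longrightarrow> 0 \<le> B \<longrightarrow> B \<le> B\<^sub>0 \<longrightarrow>
         radial_solution A\<^sub>p A\<^sub>m t\<^sub>p t\<^sub>m B n m f\<^sub>p f\<^sub>m \<longrightarrow>
         (\<forall>r>0. deriv f\<^sub>p r \<ge> 0 \<and> deriv f\<^sub>m r \<ge> 0)"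
    \<comment> \<open>With \<open>B <= 1 / C\<close> the coupling quantity is at most 1, hence at
      most the square of either nonzero integer degree.\<close>
    proof (intro exI[of _ "min B1 (1 / C)"] conjI allI impI)
      show "0 < min B1 (1 / C)" using B1 by simp
      fix B f g r
      assume B: "0 \<le> B" "B \<le> min B1 (1 / C)"
        and sol: "radial_solution A\<^sub>p A\<^sub>m t\<^sub>p t\<^sub>m B n m f g" and r: "(r::real) > 0"
      have pair: "radial_pair A\<^sub>p A\<^sub>m t\<^sub>p B t\<^sub>m n m f g" by (rule radial_solution_imp_pair[OF sol assms(3,4)])
      interpret radial_pair A\<^sub>p A\<^sub>m t\<^sub>p B t\<^sub>m n m f g by (rule pair)
      have "B * z \<le> 1" if "\<bar>z\<bar> \<le> C" for z
      proof -
        have "B * z \<le> 1 / C * C" using B B1 that by (intro order_trans[OF mult_left_mono mult_right_mono]) auto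
        then show ?thesis using B1 by simp
      qed
      then have weak: "B * (x ^ 3 * (f x * deriv f x)) \<le> 1" "B * (x ^ 3 * (g x * deriv g x)) \<le> 1" if "x > 0" for x
        using decay[OF B(1) _ pair that] B(2) that by (auto simp: abs_mult)
      show "deriv f r \<ge> 0"
        by (rule P.deriv_nonneg_of_weak_coupling[OF assms(1) _ r])
          (use weak(2) P.n_square_ge_1[OF n(1)] in \<open>auto intro: order_trans\<close>)
      show "deriv g r \<ge> 0"
        by (rule Q.deriv_nonneg_of_weak_coupling[OF assms(2) _ r])
          (use weak(1) Q.n_square_ge_1[OF n(2)] in \<open>auto intro: order_trans\<close>)
    qed
  qed
qed

end
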